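(* Let $(A,M)$ be a local ring with maximal ideal $M$, let $E$ be an $A$-module such that $ME = 0$, and let $R := A \propto E$ be the trivial ring extension of $A$ by $E$. Then $R$ is a weakly coherent ring if and only if one of the following two properties holds: (1) $E$ is an $A/M$-vector space with infinite rank (i.e. infinite dimension). (2) $E$ is an $A/M$-vector space with finite rank (i.e. finite dimension) and $A$ is weakly coherent.
   Context: All rings are commutative with identity and all modules are unital. A local ring is a ring with a unique maximal ideal (not assumed Noetherian). For a ring $A$ and an $A$-module $E$, the trivial ring extension $A \propto E$ of $A$ by $E$ is the set of pairs $(a,e)$ with $a \in A$, $e \in E$, with componentwise addition and multiplication $(a,e)(b,f) = (ab, af+be)$. Since $ME=0$, $E$ is naturally an $A/M$-vector space. A ring $R$ is called weakly coherent (also "weak coherent") if for all proper ideals $I \subseteq J$ of $R$ such that $I$ is finitely generated and $J$ is finitely presented (as $R$-modules), the ideal $I$ is finitely presented. *)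

theory Defs
  imports "HOL-Algebra.QuotRing" "Jordan_Normal_Form.Missing_VectorSpace"
begin

locale local_ring = cring A for A (structure) and M +
  assumes maximal: "maximalideal M A"
    and unique: "\<And>N. maximalideal N A \<Longrightarrow> N = M"

definition trivial_extension ::
    "('a, 'm) ring_scheme \<Rightarrow> ('a, 'b, 'n) module_scheme \<Rightarrow> ('a \<times> 'b) ring"
    (infixl \<open>\<propto>\<close> 65)
  where "A \<propto> E =
    \<lparr>carrier = carrier A \<times> carrier E,
     mult = (\<lambda>(a, e) (b, f). (a \<otimes>\<^bsub>A\<^esub> b, a \<odot>\<^bsub>E\<^esub> f \<oplus>\<^bsub>E\<^esub> b \<odot>\<^bsub>E\<^esub> e)),
     one = (\<one>\<^bsub>A\<^esub>, \<zero>\<^bsub>E\<^esub>),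
     zero = (\<zero>\<^bsub>A\<^esub>, \<zero>\<^bsub>E\<^esub>),
     add = (\<lambda>(a, e) (b, f). (a \<oplus>\<^bsub>A\<^esub> b, e \<oplus>\<^bsub>E\<^esub> f))\<rparr>"

text \<open>When \<open>M\<close> annihilates \<open>E\<close>, the set \<open>{a \<odot> e | a \<in> C}\<close> is a singleton for
  every coset \<open>C\<close> of \<open>M\<close>, and its element is the value of the scalar \<open>C\<close> at \<open>e\<close>.\<close>

definition residue_space ::
    "('a, 'b, 'n) module_scheme \<Rightarrow> ('a set, 'b) module"
  where "residue_space E =
    \<lparr>carrier = carrier E, mult = mult E, one = one E, zero = zero E, add = add E,
     smult = (\<lambda>C e. the_elem ((\<lambda>a. a \<odot>\<^bsub>E\<^esub> e) ` C))\<rparr>"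

definition fin_gen_module :: "('a, 'm) ring_scheme \<Rightarrow> ('a, 'b, 'n) module_scheme \<Rightarrow> bool"
  where "fin_gen_module R N \<longleftrightarrow>
    module R N \<and> (\<exists>S. finite S \<and> S \<subseteq> carrier N \<and> module.span R N S = carrier N)"

text \<open>\<open>ring.func_space R {..<n}\<close> is the free module of rank \<open>n\<close> over \<open>R\<close>.\<close>

definition fin_pres_module :: "('a, 'm) ring_scheme \<Rightarrow> ('a, 'b, 'n) module_scheme \<Rightarrow> bool"
  where "fin_pres_module R N \<longleftrightarrow>
    module R N \<and>
    (\<exists>(n::nat) \<phi>. let F = ring.func_space R {..<n} in
       \<phi> \<in> module_hom R F N \<and> \<phi> ` carrier F = carrier N \<and>
       fin_gen_module R (F\<lparr>carrier := {v \<in> carrier F. \<phi> v = \<zero>\<^bsub>N\<^esub>}\<rparr>))"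

definition ideal_module :: "('a, 'm) ring_scheme \<Rightarrow> 'a set \<Rightarrow> ('a, 'a) module"
  where "ideal_module R I =
    \<lparr>carrier = I, mult = mult R, one = one R, zero = zero R, add = add R, smult = mult R\<rparr>"

locale weakly_coherent_ring = cring R for R (structure) +
  assumes weakly_coherent:
    "\<And>I J. ideal I R \<Longrightarrow> ideal J R \<Longrightarrow> I \<noteq> carrier R \<Longrightarrow> J \<noteq> carrier R \<Longrightarrow> I \<subseteq> J \<Longrightarrow>
      fin_gen_module R (ideal_module R I) \<Longrightarrow> fin_pres_module R (ideal_module R J) \<Longrightarrow>
      fin_pres_module R (ideal_module R I)"

end

theory Submission
  imports Defs
begin

text \<open>
  Let \<open>R = A \<propto> E\<close>, a local ring with maximal ideal \<open>M \<times> E\<close>. If \<open>c\<^sub>1, \<dots>, c\<^sub>n\<close> are minimal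
  generators of a proper ideal of \<open>R\<close>, then by minimality their syzygies have entries in \<open>M \<times> E\<close>.
  Since \<open>M E = 0\<close>, the module of these syzygies is \<open>U \<times> E\<^sup>n\<close>, where \<open>U\<close> consists of the syzygies
  with entries in \<open>M\<close> of the first components of the \<open>c\<^sub>i\<close>, and it is finitely generated over
  \<open>R\<close> if and only if \<open>U\<close> and (for \<open>n > 0\<close>) \<open>E\<close> are finitely generated over \<open>A\<close>. So if \<open>E\<close> has
  infinite rank, the only finitely presented proper ideal of \<open>R\<close> is \<open>0\<close>.

  Let \<open>E\<close> have finite rank. For minimal generators of an ideal of \<open>A\<close>, \<open>U\<close> is the full syzygy
  module, so \<open>A\<close> inherits weak coherence from \<open>R\<close> through the ideals \<open>I \<times> 0\<close>. In the converse
  direction the first components of minimal generators need not be minimal, but the syzygy module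
  differs from \<open>U\<close> only by a finite-dimensional vector space. If they are not minimal for a finitely
  presented \<open>J\<close>, then \<open>M\<close> is finitely generated, and \<open>U\<close> is finitely generated as soon as the
  syzygy module is; if they are minimal for \<open>J\<close>, then they are minimal for every ideal \<open>I \<subseteq> J\<close>.
\<close>

section \<open>Finitely generated modules\<close>

definition fin_spanned :: "('a, 'm) ring_scheme \<Rightarrow> ('a, 'b, 'n) module_scheme \<Rightarrow> 'b set \<Rightarrow> bool"
  where "fin_spanned R N X \<longleftrightarrow> (\<exists>T. finite T \<and> T \<subseteq> carrier N \<and> X \<subseteq> module.span R N T)"

lemma (in module) span_closed_add:
  assumes "S \<subseteq> carrier M" "x \<in> span S" "y \<in> span S"
  shows "x \<oplus>\<^bsub>M\<^esub> y \<in> span S"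
  using span_is_submodule[OF assms(1)] assms(2,3) by (rule submodule.m_closed)

lemma (in module) span_closed_smult:
  assumes "S \<subseteq> carrier M" "r \<in> carrier R" "x \<in> span S"
  shows "r \<odot>\<^bsub>M\<^esub> x \<in> span S"
  using span_is_submodule[OF assms(1)] assms(2,3) by (rule submodule.smult_closed)

lemma (in module) fin_spanned_add:
  assumes "fin_spanned R M X" "fin_spanned R M Y"
    and "\<And>z. z \<in> Z \<Longrightarrow> \<exists>x\<in>X. \<exists>y\<in>Y. z = x \<oplus>\<^bsub>M\<^esub> y"
  shows "fin_spanned R M Z"
proof -
  from assms obtain S T where S: "finite S" "S \<subseteq> carrier M" "X \<subseteq> span S"
    and T: "finite T" "T \<subseteq> carrier M" "Y \<subseteq> span T"
    unfolding fin_spanned_def by blast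
  have "Z \<subseteq> span (S \<union> T)"
  proof
    fix z assume "z \<in> Z"
    then obtain x y where "x \<in> X" "y \<in> Y" "z = x \<oplus>\<^bsub>M\<^esub> y" using assms(3) by blast
    moreover from this have "x \<in> span (S \<union> T)" "y \<in> span (S \<union> T)"
      using S(3) T(3) span_is_monotone[of S "S \<union> T"] span_is_monotone[of T "S \<union> T"] by blast+
    ultimately show "z \<in> span (S \<union> T)"
      using span_closed_add[of "S \<union> T" x y] S(2) T(2) by simp
  qed
  then show ?thesis
    unfolding fin_spanned_def using S T by (intro exI[of _ "S \<union> T"]) auto
qed

lemma fin_gen_module_iff:
  "fin_gen_module R N \<longleftrightarrow> module R N \<and> fin_spanned R N (carrier N)"
proof -
  have "module.span R N S = carrier N \<longleftrightarrow> carrier N \<subseteq> module.span R N S"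
    if "module R N" "S \<subseteq> carrier N" for S
    using module.span_is_subset2[OF that] by auto
  then show ?thesis
    unfolding fin_gen_module_def fin_spanned_def by auto
qed

lemma fin_spanned_semilinear_image:
  assumes fg: "fin_gen_module R N" and N': "module A N'"
    and h: "h \<in> carrier N \<rightarrow> carrier N'" and \<sigma>: "\<sigma> \<in> carrier R \<rightarrow> carrier A"
    and add: "\<And>x y. x \<in> carrier N \<Longrightarrow> y \<in> carrier N \<Longrightarrow> h (x \<oplus>\<^bsub>N\<^esub> y) = h x \<oplus>\<^bsub>N'\<^esub> h y"
    and smult: "\<And>r x. r \<in> carrier R \<Longrightarrow> x \<in> carrier N \<Longrightarrow> h (r \<odot>\<^bsub>N\<^esub> x) = \<sigma> r \<odot>\<^bsub>N'\<^esub> h x"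
  shows "fin_spanned A N' (h ` carrier N)"
proof -
  from fg obtain S where S: "finite S" "S \<subseteq> carrier N" "module.span R N S = carrier N"
    and modN: "module R N"
    unfolding fin_gen_module_def by blast
  interpret N: module R N by (rule modN)
  interpret N': module A N' by (rule N')
  have hS: "h ` S \<subseteq> carrier N'" using h S(2) by auto
  have "h \<zero>\<^bsub>N\<^esub> = h \<zero>\<^bsub>N\<^esub> \<oplus>\<^bsub>N'\<^esub> h \<zero>\<^bsub>N\<^esub>"
    using add[of "\<zero>\<^bsub>N\<^esub>" "\<zero>\<^bsub>N\<^esub>"] by simp
  moreover have "h \<zero>\<^bsub>N\<^esub> \<in> carrier N'" using h by auto
  ultimately have h0: "h \<zero>\<^bsub>N\<^esub> = \<zero>\<^bsub>N'\<^esub>" by (simp add: N'.M.add.r_cancel_one')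
  define H where "H = {x \<in> carrier N. h x \<in> N'.span (h ` S)}"
  have "submodule R H N"
  proof (rule submodule.intro)
    show "\<zero>\<^bsub>N\<^esub> \<in> H"
      using submodule.zero_closed[OF N'.span_is_submodule[OF hS]] by (simp add: H_def h0)
  qed (auto simp: H_def add smult modN intro!: N'.span_closed_add[OF hS] N'.span_closed_smult[OF hS] funcset_mem[OF \<sigma>])
  moreover have "S \<subseteq> H" using S(2) N'.in_own_span[OF hS] by (auto simp: H_def)
  ultimately have "carrier N \<subseteq> H" using N.span_is_subset S(3) by metis
  then have "h ` carrier N \<subseteq> N'.span (h ` S)" by (auto simp: H_def)
  then show ?thesis unfolding fin_spanned_def using S(1) hS by blast
qed

lemma fin_gen_semilinear_image:
  assumes "fin_gen_module R N" "module A N'"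
    and "h \<in> carrier N \<rightarrow> carrier N'" "\<sigma> \<in> carrier R \<rightarrow> carrier A"
    and "\<And>x y. x \<in> carrier N \<Longrightarrow> y \<in> carrier N \<Longrightarrow> h (x \<oplus>\<^bsub>N\<^esub> y) = h x \<oplus>\<^bsub>N'\<^esub> h y"
    and "\<And>r x. r \<in> carrier R \<Longrightarrow> x \<in> carrier N \<Longrightarrow> h (r \<odot>\<^bsub>N\<^esub> x) = \<sigma> r \<odot>\<^bsub>N'\<^esub> h x"
    and surj: "carrier N' \<subseteq> h ` carrier N"
  shows "fin_gen_module A N'"
proof -
  have "h ` carrier N = carrier N'" using assms(3) surj by auto
  then show ?thesis
    using fin_spanned_semilinear_image[OF assms(1-6)] assms(2) by (simp add: fin_gen_module_iff)
qed

lemma fin_gen_hom_image: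
  assumes "fin_gen_module R N" "module R N'" and f: "f \<in> module_hom R N N'"
    and "carrier N' \<subseteq> f ` carrier N"
  shows "fin_gen_module R N'"
proof (rule fin_gen_semilinear_image[where h = f and \<sigma> = "\<lambda>r. r"])
  show "f \<in> carrier N \<rightarrow> carrier N'" by (rule module_hom_closed[OF f])
qed (use assms module_hom_add[OF f] module_hom_smult[OF f] in auto)

abbreviation free_module :: "('a, 'm) ring_scheme \<Rightarrow> nat \<Rightarrow> ('a, nat \<Rightarrow> 'a) module"
  where "free_module R n \<equiv> ring.func_space R {..<n}"

definition unit_vec :: "('a, 'm) ring_scheme \<Rightarrow> nat \<Rightarrow> nat \<Rightarrow> nat \<Rightarrow> 'a"
  where "unit_vec R n i = (\<lambda>j\<in>{..<n}. if j = i then \<one>\<^bsub>R\<^esub> else \<zero>\<^bsub>R\<^esub>)"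

primrec lin_comb :: "('a, 'b, 'n) module_scheme \<Rightarrow> (nat \<Rightarrow> 'b) \<Rightarrow> (nat \<Rightarrow> 'a) \<Rightarrow> nat \<Rightarrow> 'b"
  where
    "lin_comb N x r 0 = \<zero>\<^bsub>N\<^esub>"
  | "lin_comb N x r (Suc n) = lin_comb N x r n \<oplus>\<^bsub>N\<^esub> r n \<odot>\<^bsub>N\<^esub> x n"

context cring begin

lemma func_space_simps [simp]:
  "carrier (func_space S) = S \<rightarrow>\<^sub>E carrier R"
  "\<zero>\<^bsub>func_space S\<^esub> = (\<lambda>v\<in>S. \<zero>)"
  "f \<oplus>\<^bsub>func_space S\<^esub> g = (\<lambda>v\<in>S. f v \<oplus> g v)"
  "c \<odot>\<^bsub>func_space S\<^esub> f = (\<lambda>v\<in>S. c \<otimes> f v)"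
  by (simp_all add: func_space_def)

lemma unit_vec_closed: "unit_vec R n i \<in> {..<n} \<rightarrow>\<^sub>E carrier R"
  by (auto simp: unit_vec_def)

lemma free_module_subset_submodule:
  assumes H: "submodule R H (free_module R n)" and u: "\<And>i. i < n \<Longrightarrow> unit_vec R n i \<in> H"
  shows "carrier (free_module R n) \<subseteq> H"
proof -
  have *: "r \<in> H" if "k \<le> n" "r \<in> {..<n} \<rightarrow>\<^sub>E carrier R" "\<And>i. k \<le> i \<Longrightarrow> i < n \<Longrightarrow> r i = \<zero>" for k r
    using that
  proof (induction k arbitrary: r)
    case 0
    then have "r = (\<lambda>v\<in>{..<n}. \<zero>)"
      by (intro extensionalityI[of _ "{..<n}"]) (auto simp: PiE_iff)
    then show ?case using submodule.zero_closed[OF H] by (metis func_space_simps(2))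
  next
    case (Suc k)
    let ?s = "r(k := \<zero>)"
    have rc: "\<And>i. i < n \<Longrightarrow> r i \<in> carrier R" using Suc.prems(2) by auto
    have "?s \<in> {..<n} \<rightarrow>\<^sub>E carrier R" using Suc.prems(1,2)
      by (auto simp: PiE_iff extensional_def)
    moreover have "?s i = \<zero>" if "k \<le> i" "i < n" for i
      using Suc.prems(3)[of i] that by (cases "i = k") simp_all
    ultimately have "?s \<in> H" using Suc.prems(1) Suc.IH Suc_leD by blast
    moreover have "r k \<odot>\<^bsub>free_module R n\<^esub> unit_vec R n k \<in> H"
      using Suc.prems by (intro submodule.smult_closed[OF H] u rc) auto
    moreover have "r = ?s \<oplus>\<^bsub>free_module R n\<^esub> (r k \<odot>\<^bsub>free_module R n\<^esub> unit_vec R n k)"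
      using Suc.prems(1,2) rc
      by (intro extensionalityI[of _ "{..<n}"]) (auto simp: unit_vec_def PiE_iff)
    ultimately show ?case using submodule.m_closed[OF H] by metis
  qed
  show ?thesis
  proof
    fix r assume "r \<in> carrier (free_module R n)"
    then show "r \<in> H" by (intro *[of n]) simp_all
  qed
qed

lemma fin_gen_free_module: "fin_gen_module R (free_module R n)"
proof -
  interpret F: module R "free_module R n" by (rule func_space_is_module)
  have sub: "unit_vec R n ` {..<n} \<subseteq> carrier (free_module R n)" using unit_vec_closed by auto
  have "carrier (free_module R n) \<subseteq> F.span (unit_vec R n ` {..<n})"
    using F.in_own_span[OF sub]
    by (intro free_module_subset_submodule F.span_is_submodule sub) auto
  then show ?thesis
    unfolding fin_gen_module_iff fin_spanned_def
    using sub F.module_axioms by blast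
qed

end

context module begin

lemma lin_comb_in_submodule:
  assumes H: "submodule R H M" and "\<And>i. i < n \<Longrightarrow> r i \<in> carrier R" "\<And>i. i < n \<Longrightarrow> x i \<in> H"
  shows "lin_comb M x r n \<in> H"
  using assms(2,3)
  by (induction n) (auto intro!: submodule.m_closed[OF H] submodule.smult_closed[OF H]
      submodule.zero_closed[OF H])

lemma carrier_submodule: "submodule R (carrier M) M"
  by (rule submodule.intro) (auto simp: module_axioms)

lemma lin_comb_closed:
  assumes "\<And>i. i < n \<Longrightarrow> r i \<in> carrier R" "\<And>i. i < n \<Longrightarrow> x i \<in> carrier M"
  shows "lin_comb M x r n \<in> carrier M"
  using lin_comb_in_submodule[OF carrier_submodule] assms by blast

lemma lin_comb_cong:
  assumes "\<And>i. i < n \<Longrightarrow> r i = s i" "\<And>i. i < n \<Longrightarrow> x i = y i"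
  shows "lin_comb M x r n = lin_comb M y s n"
  using assms by (induction n) auto

lemma lin_comb_add:
  assumes "\<And>i. i < n \<Longrightarrow> r i \<in> carrier R" "\<And>i. i < n \<Longrightarrow> s i \<in> carrier R"
    "\<And>i. i < n \<Longrightarrow> x i \<in> carrier M"
  shows "lin_comb M x (\<lambda>i. r i \<oplus> s i) n = lin_comb M x r n \<oplus>\<^bsub>M\<^esub> lin_comb M x s n"
  using assms
proof (induction n)
  case (Suc n)
  then show ?case
    using lin_comb_closed[of n r x] lin_comb_closed[of n s x]
    by (simp add: smult_l_distr M.a_ac)
qed simp

lemma lin_comb_smult:
  assumes "c \<in> carrier R" "\<And>i. i < n \<Longrightarrow> r i \<in> carrier R" "\<And>i. i < n \<Longrightarrow> x i \<in> carrier M"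
  shows "lin_comb M x (\<lambda>i. c \<otimes> r i) n = c \<odot>\<^bsub>M\<^esub> lin_comb M x r n"
  using assms
proof (induction n)
  case (Suc n)
  then show ?case
    using lin_comb_closed[of n r x] by (simp add: smult_r_distr smult_assoc1)
qed simp

lemma lin_comb_eq_zero:
  assumes "\<And>i. i < n \<Longrightarrow> r i \<odot>\<^bsub>M\<^esub> x i = \<zero>\<^bsub>M\<^esub>"
  shows "lin_comb M x r n = \<zero>\<^bsub>M\<^esub>"
  using assms by (induction n) auto

lemma lin_comb_hom:
  assumes "\<And>i. i < n \<Longrightarrow> x i \<in> carrier M"
  shows "(\<lambda>r. lin_comb M x r n) \<in> module_hom R (free_module R n) M"
proof -
  have coeff: "r i \<in> carrier R" if "r \<in> {..<n} \<rightarrow>\<^sub>E carrier R" "i < n" for r i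
    using that by auto
  have "lin_comb M x (\<lambda>v\<in>{..<n}. r v \<oplus> s v) n = lin_comb M x r n \<oplus>\<^bsub>M\<^esub> lin_comb M x s n"
    if "r \<in> {..<n} \<rightarrow>\<^sub>E carrier R" "s \<in> {..<n} \<rightarrow>\<^sub>E carrier R" for r s
  proof -
    have "lin_comb M x (\<lambda>v\<in>{..<n}. r v \<oplus> s v) n = lin_comb M x (\<lambda>i. r i \<oplus> s i) n"
      by (rule lin_comb_cong) simp_all
    then show ?thesis using lin_comb_add[of n r s x] coeff that assms by simp
  qed
  moreover have "lin_comb M x (\<lambda>v\<in>{..<n}. c \<otimes> r v) n = c \<odot>\<^bsub>M\<^esub> lin_comb M x r n"
    if "r \<in> {..<n} \<rightarrow>\<^sub>E carrier R" "c \<in> carrier R" for r c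
  proof -
    have "lin_comb M x (\<lambda>v\<in>{..<n}. c \<otimes> r v) n = lin_comb M x (\<lambda>i. c \<otimes> r i) n"
      by (rule lin_comb_cong) simp_all
    then show ?thesis using lin_comb_smult[of c n r x] coeff that assms by simp
  qed
  moreover have "lin_comb M x r n \<in> carrier M" if "r \<in> {..<n} \<rightarrow>\<^sub>E carrier R" for r
    using coeff[OF that] assms by (intro lin_comb_closed)
  ultimately show ?thesis
    by (simp add: module_hom_def)
qed

lemma lin_comb_unit_vec:
  assumes "\<And>i. i < n \<Longrightarrow> x i \<in> carrier M" "j < n"
  shows "lin_comb M x (unit_vec R n j) n = x j"
proof -
  have "lin_comb M x (unit_vec R n j) k = (if j < k then x j else \<zero>\<^bsub>M\<^esub>)" if "k \<le> n" for k
    using that assms by (induction k) (auto simp: unit_vec_def less_Suc_eq)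
  then show ?thesis using assms by simp
qed

lemma lin_comb_coeff_in_submodule:
  assumes H: "submodule R H M" and "\<And>i. i < n \<Longrightarrow> r i \<in> carrier R"
    and "\<And>i. i < n \<Longrightarrow> x i \<in> carrier M" "\<And>i. i < n \<Longrightarrow> i \<noteq> j \<Longrightarrow> x i \<in> H"
    and "lin_comb M x r n \<in> H" "j < n"
  shows "r j \<odot>\<^bsub>M\<^esub> x j \<in> H"
  using assms(2-)
proof (induction n)
  case (Suc n)
  have diff: "y \<in> H" if "x \<oplus>\<^bsub>M\<^esub> y \<in> H" "x \<in> H" "y \<in> carrier M" for x y
  proof -
    have xc: "x \<in> carrier M" using submodule.subset[OF H] that(2) by auto
    have "(\<ominus> \<one>) \<odot>\<^bsub>M\<^esub> x \<oplus>\<^bsub>M\<^esub> (x \<oplus>\<^bsub>M\<^esub> y) \<in> H"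
      using that(1,2) by (rule_tac submodule.m_closed[OF H]) (auto intro: submodule.smult_closed[OF H])
    moreover have "(\<ominus> \<one>) \<odot>\<^bsub>M\<^esub> x \<oplus>\<^bsub>M\<^esub> (x \<oplus>\<^bsub>M\<^esub> y) = y"
      using xc that(3) by (simp only: smult_minus_1 M.r_neg1)
    ultimately show ?thesis by metis
  qed
  have lc: "lin_comb M x r n \<in> carrier M" using Suc.prems by (intro lin_comb_closed) auto
  show ?case
  proof (cases "j = n")
    case True
    then have "lin_comb M x r n \<in> H" using Suc.prems by (intro lin_comb_in_submodule[OF H]) auto
    then show ?thesis using diff[of "lin_comb M x r n" "r n \<odot>\<^bsub>M\<^esub> x n"] Suc.prems True by auto
  next
    case False
    then have "r n \<odot>\<^bsub>M\<^esub> x n \<in> H" using Suc.prems by (intro submodule.smult_closed[OF H]) auto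
    then have "lin_comb M x r n \<in> H"
      using diff[of "r n \<odot>\<^bsub>M\<^esub> x n" "lin_comb M x r n"] Suc.prems lc by (simp add: M.a_comm)
    then show ?thesis using Suc False by auto
  qed
qed simp

end

section \<open>Comparison of presentations\<close>

lemma submodule_hom_kernel:
  assumes "module R F" "module R N" "\<psi> \<in> module_hom R F N"
  shows "submodule R {v \<in> carrier F. \<psi> v = \<zero>\<^bsub>N\<^esub>} F"
proof -
  interpret mod_hom R F N \<psi>
    using assms by (intro mod_hom.intro mod_hom_axioms.intro)
  show ?thesis using ker_is_submodule by (simp add: ker_def)
qed

lemma (in cring) free_module_lift:
  assumes G: "module R G" and N: "module R N"
    and \<phi>: "\<phi> \<in> module_hom R (free_module R n) N"
    and \<psi>: "\<psi> \<in> module_hom R G N" and surj: "\<psi> ` carrier G = carrier N"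
  obtains P where "P \<in> module_hom R (free_module R n) G"
    and "\<And>w. w \<in> carrier (free_module R n) \<Longrightarrow> \<psi> (P w) = \<phi> w"
proof -
  let ?F = "free_module R n"
  interpret F: module R ?F by (rule func_space_is_module)
  interpret G: module R G by (rule G)
  interpret \<psi>: mod_hom R G N \<psi>
    by (intro mod_hom.intro mod_hom_axioms.intro G N \<psi>)
  interpret \<phi>: mod_hom R ?F N \<phi>
    by (intro mod_hom.intro mod_hom_axioms.intro N \<phi> F.module_axioms)
  have u: "unit_vec R n i \<in> carrier ?F" for i using unit_vec_closed by simp
  have "\<exists>p. p \<in> carrier G \<and> \<psi> p = \<phi> (unit_vec R n i)" for i
    using surj \<phi>.f_im[OF u[of i]] by (metis imageE)
  then obtain p where p: "\<And>i. p i \<in> carrier G" "\<And>i. \<psi> (p i) = \<phi> (unit_vec R n i)"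
    by metis
  let ?P = "\<lambda>r. lin_comb G p r n"
  have P: "?P \<in> module_hom R ?F G" using p(1) by (intro G.lin_comb_hom)
  interpret P: mod_hom R ?F G ?P
    by (intro mod_hom.intro mod_hom_axioms.intro G P F.module_axioms)
  define H where "H = {w \<in> carrier ?F. \<psi> (?P w) = \<phi> w}"
  have "submodule R H ?F"
  proof (rule submodule.intro)
    fix v w assume "v \<in> H" "w \<in> H"
    then have vw: "v \<in> carrier ?F" "w \<in> carrier ?F" "\<psi> (?P v) = \<phi> v" "\<psi> (?P w) = \<phi> w"
      unfolding H_def by blast+
    then have "\<psi> (?P (v \<oplus>\<^bsub>?F\<^esub> w)) = \<phi> (v \<oplus>\<^bsub>?F\<^esub> w)"
      by (simp only: P.f_add \<phi>.f_add \<psi>.f_add P.f_im)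
    then show "v \<oplus>\<^bsub>?F\<^esub> w \<in> H" using vw F.M.add.m_closed unfolding H_def by blast
  next
    fix c w assume c: "c \<in> carrier R" and "w \<in> H"
    then have w: "w \<in> carrier ?F" "\<psi> (?P w) = \<phi> w"
      unfolding H_def by blast+
    then have "\<psi> (?P (c \<odot>\<^bsub>?F\<^esub> w)) = \<phi> (c \<odot>\<^bsub>?F\<^esub> w)"
      by (simp only: P.f_smult \<phi>.f_smult \<psi>.f_smult P.f_im c)
    then show "c \<odot>\<^bsub>?F\<^esub> w \<in> H" using w c F.smult_closed unfolding H_def by blast
  next
    have "\<psi> (?P \<zero>\<^bsub>?F\<^esub>) = \<phi> \<zero>\<^bsub>?F\<^esub>"
      by (simp only: P.f0_is_0 \<phi>.f0_is_0 \<psi>.f0_is_0)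
    then show "\<zero>\<^bsub>?F\<^esub> \<in> H" using F.M.zero_closed unfolding H_def by blast
  qed (auto simp: H_def F.module_axioms)
  moreover have "unit_vec R n i \<in> H" if "i < n" for i
    using u that p by (simp add: H_def G.lin_comb_unit_vec)
  ultimately have "carrier ?F \<subseteq> H" by (rule free_module_subset_submodule)
  then have "\<psi> (?P w) = \<phi> w" if "w \<in> carrier ?F" for w
    using that unfolding H_def by blast
  then show ?thesis using that P by blast
qed

text \<open>A variant of Schanuel's lemma: if \<open>P\<close> and \<open>Q\<close> lift two presentations to each other, then the
  kernel of the second one is \<open>P (ker \<phi>) + (1 - P \<circ> Q) G\<close>.\<close>

lemma fin_pres_module_fin_gen_kernel:
  assumes "fin_pres_module R N"
    and \<psi>: "\<psi> \<in> module_hom R (free_module R m) N"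
    and surj: "\<psi> ` carrier (free_module R m) = carrier N"
  shows "fin_gen_module R ((free_module R m)\<lparr>carrier :=
           {v \<in> carrier (free_module R m). \<psi> v = \<zero>\<^bsub>N\<^esub>}\<rparr>)"
proof -
  from assms(1) obtain n \<phi> where N: "module R N"
    and \<phi>: "\<phi> \<in> module_hom R (free_module R n) N"
    and \<phi>surj: "\<phi> ` carrier (free_module R n) = carrier N"
    and fg: "fin_gen_module R ((free_module R n)\<lparr>carrier :=
        {v \<in> carrier (free_module R n). \<phi> v = \<zero>\<^bsub>N\<^esub>}\<rparr>)"
    unfolding fin_pres_module_def Let_def by blast
  let ?F = "free_module R n" and ?G = "free_module R m"
  let ?K = "?F\<lparr>carrier := {v \<in> carrier ?F. \<phi> v = \<zero>\<^bsub>N\<^esub>}\<rparr>"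
  let ?L = "?G\<lparr>carrier := {v \<in> carrier ?G. \<psi> v = \<zero>\<^bsub>N\<^esub>}\<rparr>"
  interpret N: module R N by (rule N)
  interpret F: module R ?F by (rule N.func_space_is_module)
  interpret G: module R ?G by (rule N.func_space_is_module)
  interpret \<psi>: mod_hom R ?G N \<psi>
    by (intro mod_hom.intro mod_hom_axioms.intro G.module_axioms N \<psi>)
  have L: "module R ?L"
    by (intro G.submodule_is_module submodule_hom_kernel[OF G.module_axioms N \<psi>])
  interpret L: module R ?L by (rule L)
  obtain P where P: "P \<in> module_hom R ?F ?G" "\<And>w. w \<in> carrier ?F \<Longrightarrow> \<psi> (P w) = \<phi> w"
    using N.free_module_lift[OF G.module_axioms N \<phi> \<psi> surj] by blast
  obtain Q where Q: "Q \<in> module_hom R ?G ?F" "\<And>w. w \<in> carrier ?G \<Longrightarrow> \<phi> (Q w) = \<psi> w"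
    using N.free_module_lift[OF F.module_axioms N \<psi> \<phi> \<phi>surj] by blast
  interpret P: mod_hom R ?F ?G P
    by (intro mod_hom.intro mod_hom_axioms.intro G.module_axioms F.module_axioms P)
  interpret Q: mod_hom R ?G ?F Q
    by (intro mod_hom.intro mod_hom_axioms.intro G.module_axioms F.module_axioms Q)
  let ?D = "\<lambda>w. w \<ominus>\<^bsub>?G\<^esub> P (Q w)"
  have D: "?D w \<in> carrier ?G" "\<psi> (?D w) = \<zero>\<^bsub>N\<^esub>" if "w \<in> carrier ?G" for w
  proof -
    have PQ: "Q w \<in> carrier ?F" "P (Q w) \<in> carrier ?G" using that by (auto simp del: N.func_space_simps)
    then show "?D w \<in> carrier ?G" using that G.M.minus_closed by blast
    have "\<psi> (?D w) = \<psi> w \<ominus>\<^bsub>N\<^esub> \<psi> (P (Q w))" using that PQ(2) by (rule \<psi>.f_minus)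
    also have "\<psi> (P (Q w)) = \<psi> w" using P(2)[OF PQ(1)] Q(2)[OF that] by simp
    finally show "\<psi> (?D w) = \<zero>\<^bsub>N\<^esub>" using \<psi>.f_im[OF that] by simp
  qed
  have "fin_spanned R ?L (P ` carrier ?K)"
  proof (rule fin_spanned_semilinear_image[OF fg L, where \<sigma> = "\<lambda>r. r"])
    show "P \<in> carrier ?K \<rightarrow> carrier ?L"
      using P.f_im P(2) by (auto simp del: N.func_space_simps)
  qed (auto simp del: N.func_space_simps)
  moreover have "fin_spanned R ?L (?D ` carrier ?G)"
  proof (rule fin_spanned_semilinear_image[OF N.fin_gen_free_module L, where \<sigma> = "\<lambda>r. r"])
    have "carrier ?L = {v \<in> carrier ?G. \<psi> v = \<zero>\<^bsub>N\<^esub>}" by simp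
    then show "?D \<in> carrier ?G \<rightarrow> carrier ?L" using D by blast
  next
    fix x y assume xy: "x \<in> carrier ?G" "y \<in> carrier ?G"
    then have "P (Q x) \<in> carrier ?G" "P (Q y) \<in> carrier ?G"
      using Q.f_im P.f_im by blast+
    then show "?D (x \<oplus>\<^bsub>?G\<^esub> y) = ?D x \<oplus>\<^bsub>?L\<^esub> ?D y"
      using xy by (simp add: G.M.minus_eq G.M.minus_add G.M.a_ac del: N.func_space_simps)
  next
    fix r x assume rx: "r \<in> carrier R" "x \<in> carrier ?G"
    then have "P (Q x) \<in> carrier ?G" using Q.f_im P.f_im by blast
    then show "?D (r \<odot>\<^bsub>?G\<^esub> x) = r \<odot>\<^bsub>?L\<^esub> ?D x"
      using rx by (simp add: G.M.minus_eq G.smult_r_distr G.smult_r_minus del: N.func_space_simps)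
  qed simp
  moreover have "\<exists>x\<in>P ` carrier ?K. \<exists>y\<in>?D ` carrier ?G. z = x \<oplus>\<^bsub>?L\<^esub> y" if "z \<in> carrier ?L" for z
  proof -
    have z: "z \<in> carrier ?G" "\<psi> z = \<zero>\<^bsub>N\<^esub>" using that by auto
    then have "Q z \<in> carrier ?K" using Q by (auto simp del: N.func_space_simps)
    moreover have "P (Q z) \<in> carrier ?G" using z(1) Q.f_im P.f_im by blast
    then have "z = P (Q z) \<oplus>\<^bsub>?L\<^esub> ?D z"
      using z by (simp add: G.M.minus_eq G.M.a_lcomm[of "P (Q z)"] G.M.r_neg del: N.func_space_simps)
    ultimately show ?thesis using z(1) by blast
  qed
  ultimately have "fin_spanned R ?L (carrier ?L)" by (rule L.fin_spanned_add)
  then show ?thesis using L by (simp only: fin_gen_module_iff)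
qed

lemma fin_pres_imp_fin_gen:
  assumes "fin_pres_module R N"
  shows "fin_gen_module R N"
proof -
  from assms obtain n \<phi> where N: "module R N"
    and \<phi>: "\<phi> \<in> module_hom R (free_module R n) N" "\<phi> ` carrier (free_module R n) = carrier N"
    unfolding fin_pres_module_def Let_def by blast
  interpret N: module R N by (rule N)
  show ?thesis
    using fin_gen_hom_image[OF N.fin_gen_free_module N \<phi>(1)] \<phi>(2) by simp
qed

section \<open>Finitely generated ideals and local rings\<close>

primrec ring_comb :: "('a, 'm) ring_scheme \<Rightarrow> (nat \<Rightarrow> 'a) \<Rightarrow> (nat \<Rightarrow> 'a) \<Rightarrow> nat \<Rightarrow> 'a"
  where
    "ring_comb R a r 0 = \<zero>\<^bsub>R\<^esub>"
  | "ring_comb R a r (Suc n) = ring_comb R a r n \<oplus>\<^bsub>R\<^esub> r n \<otimes>\<^bsub>R\<^esub> a n"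

lemma lin_comb_ideal_module: "lin_comb (ideal_module R I) a r n = ring_comb R a r n"
  by (induction n) (simp_all add: ideal_module_def)

lemma ideal_module_simps [simp]:
  "carrier (ideal_module R I) = I"
  "\<zero>\<^bsub>ideal_module R I\<^esub> = \<zero>\<^bsub>R\<^esub>"
  "x \<oplus>\<^bsub>ideal_module R I\<^esub> y = x \<oplus>\<^bsub>R\<^esub> y"
  "r \<odot>\<^bsub>ideal_module R I\<^esub> x = r \<otimes>\<^bsub>R\<^esub> x"
  by (simp_all add: ideal_module_def)

definition syzygies :: "('a, 'm) ring_scheme \<Rightarrow> (nat \<Rightarrow> 'a) \<Rightarrow> nat \<Rightarrow> (nat \<Rightarrow> 'a) set"
  where "syzygies R a n = {r \<in> {..<n} \<rightarrow>\<^sub>E carrier R. ring_comb R a r n = \<zero>\<^bsub>R\<^esub>}"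

definition syzygy_module :: "('a, 'm) ring_scheme \<Rightarrow> (nat \<Rightarrow> 'a) \<Rightarrow> nat \<Rightarrow> ('a, nat \<Rightarrow> 'a) module"
  where "syzygy_module R a n = (free_module R n)\<lparr>carrier := syzygies R a n\<rparr>"

definition gen_ideal :: "('a, 'm) ring_scheme \<Rightarrow> (nat \<Rightarrow> 'a) \<Rightarrow> nat \<Rightarrow> 'a set"
  where "gen_ideal R a n = (\<lambda>r. ring_comb R a r n) ` ({..<n} \<rightarrow>\<^sub>E carrier R)"

context cring begin

lemma ideal_module_module:
  assumes "ideal I R"
  shows "module R (ideal_module R I)"
proof -
  interpret I: ideal I R by (rule assms)
  show ?thesis
  proof (rule module_criteria)
    show "\<forall>v\<in>carrier (ideal_module R I). \<exists>neg_v\<in>carrier (ideal_module R I).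
        v \<oplus>\<^bsub>ideal_module R I\<^esub> neg_v = \<zero>\<^bsub>ideal_module R I\<^esub>"
      using I.a_inv_closed I.Icarr r_neg by (metis ideal_module_simps)
  qed (auto simp: is_cring I.I_l_closed I.Icarr a_ac m_assoc l_distr r_distr)
qed

lemma ring_as_module: "module R (ideal_module R (carrier R))"
  by (rule ideal_module_module[OF oneideal])

lemma ring_comb_in_ideal:
  assumes "ideal I R" "\<And>i. i < n \<Longrightarrow> r i \<in> carrier R" "\<And>i. i < n \<Longrightarrow> a i \<in> I"
  shows "ring_comb R a r n \<in> I"
  using module.lin_comb_closed[OF ideal_module_module[OF assms(1)], of n r a] assms(2,3)
  by (simp add: lin_comb_ideal_module)

lemma ring_comb_cong:
  assumes "\<And>i. i < n \<Longrightarrow> r i = s i" "\<And>i. i < n \<Longrightarrow> a i = b i"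
  shows "ring_comb R a r n = ring_comb R b s n"
  using assms by (induction n) auto

lemma ring_comb_hom:
  assumes "ideal I R" "\<And>i. i < n \<Longrightarrow> a i \<in> I"
  shows "(\<lambda>r. ring_comb R a r n) \<in> module_hom R (free_module R n) (ideal_module R I)"
  using module.lin_comb_hom[OF ideal_module_module[OF assms(1)], of n a] assms(2)
  by (simp add: lin_comb_ideal_module)

lemma syzygies_submodule:
  assumes "\<And>i. i < n \<Longrightarrow> a i \<in> carrier R"
  shows "submodule R (syzygies R a n) (free_module R n)"
  using submodule_hom_kernel[OF func_space_is_module ring_as_module ring_comb_hom[OF oneideal, of n a]] assms
  by (simp add: syzygies_def)

lemma syzygy_module_module:
  assumes "\<And>i. i < n \<Longrightarrow> a i \<in> carrier R"
  shows "module R (syzygy_module R a n)"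
  unfolding syzygy_module_def
  by (rule module.submodule_is_module[OF func_space_is_module syzygies_submodule[of n a, OF assms]])

lemma gen_ideal_ideal:
  assumes "\<And>i. i < n \<Longrightarrow> a i \<in> carrier R"
  shows "ideal (gen_ideal R a n) R"
proof -
  interpret h: mod_hom R "free_module R n" "ideal_module R (carrier R)" "\<lambda>r. ring_comb R a r n"
    using assms by (intro mod_hom.intro mod_hom_axioms.intro func_space_is_module
        ring_as_module ring_comb_hom[OF oneideal, of n a])
  have sub: "submodule R (gen_ideal R a n) (ideal_module R (carrier R))"
    using h.im_is_submodule by (simp add: h.im_def gen_ideal_def)
  have carr: "x \<in> carrier R" if "x \<in> gen_ideal R a n" for x
    using submodule.subset[OF sub] that by auto
  have l: "x \<otimes> y \<in> gen_ideal R a n" if "x \<in> carrier R" "y \<in> gen_ideal R a n" for x y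
    using submodule.smult_closed[OF sub that] by simp
  show ?thesis
  proof (rule idealI)
    show "subgroup (gen_ideal R a n) (add_monoid R)"
    proof (rule add.subgroupI)
      show "gen_ideal R a n \<noteq> {}" using submodule.zero_closed[OF sub] by auto
      show "\<ominus> x \<in> gen_ideal R a n" if "x \<in> gen_ideal R a n" for x
        using l[of "\<ominus> \<one>" x] carr[OF that] that by (simp add: l_minus)
      show "x \<oplus> y \<in> gen_ideal R a n" if "x \<in> gen_ideal R a n" "y \<in> gen_ideal R a n" for x y
        using submodule.m_closed[OF sub that] by simp
    qed (use carr in auto)
    show "y \<otimes> x \<in> gen_ideal R a n" if "x \<in> carrier R" "y \<in> gen_ideal R a n" for x y
      using l[OF that] m_comm[OF that(1) carr[OF that(2)]] by simp
  qed (simp_all add: l ring_axioms)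
qed

lemma gen_ideal_minimal:
  assumes "ideal I R" "\<And>i. i < n \<Longrightarrow> a i \<in> I"
  shows "gen_ideal R a n \<subseteq> I"
proof -
  have "ring_comb R a r n \<in> I" if "r \<in> {..<n} \<rightarrow>\<^sub>E carrier R" for r
    using that assms(2) by (intro ring_comb_in_ideal[OF assms(1)]) auto
  then show ?thesis by (auto simp: gen_ideal_def)
qed

lemma generator_in_gen_ideal:
  assumes "\<And>i. i < n \<Longrightarrow> a i \<in> carrier R" "j < n"
  shows "a j \<in> gen_ideal R a n"
proof -
  have "a j = ring_comb R a (unit_vec R n j) n"
    using module.lin_comb_unit_vec[OF ring_as_module, of n a j] assms
    by (simp add: lin_comb_ideal_module)
  then show ?thesis unfolding gen_ideal_def using unit_vec_closed by (rule image_eqI)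
qed

lemma fin_gen_gen_ideal:
  assumes "\<And>i. i < n \<Longrightarrow> a i \<in> carrier R"
  shows "fin_gen_module R (ideal_module R (gen_ideal R a n))"
proof -
  have I: "ideal (gen_ideal R a n) R" using assms by (rule gen_ideal_ideal)
  have hom: "(\<lambda>r. ring_comb R a r n) \<in> module_hom R (free_module R n) (ideal_module R (gen_ideal R a n))"
    using generator_in_gen_ideal[of n a, OF assms] by (intro ring_comb_hom[OF I, of n a])
  show ?thesis
    by (rule fin_gen_hom_image[OF fin_gen_free_module ideal_module_module[OF I] hom])
      (simp add: gen_ideal_def)
qed

lemma fin_pres_gen_ideal_iff:
  assumes "\<And>i. i < n \<Longrightarrow> a i \<in> carrier R"
  shows "fin_pres_module R (ideal_module R (gen_ideal R a n)) \<longleftrightarrow> fin_gen_module R (syzygy_module R a n)"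
proof -
  let ?I = "ideal_module R (gen_ideal R a n)" and ?F = "free_module R n"
  have I: "ideal (gen_ideal R a n) R" using assms by (rule gen_ideal_ideal)
  have hom: "(\<lambda>r. ring_comb R a r n) \<in> module_hom R ?F ?I"
    using generator_in_gen_ideal[of n a, OF assms] by (intro ring_comb_hom[OF I, of n a])
  have surj: "(\<lambda>r. ring_comb R a r n) ` carrier ?F = carrier ?I"
    by (simp add: gen_ideal_def)
  have eq: "?F\<lparr>carrier := {v \<in> carrier ?F. ring_comb R a v n = \<zero>\<^bsub>?I\<^esub>}\<rparr> = syzygy_module R a n"
    by (simp add: syzygy_module_def syzygies_def)
  show ?thesis
  proof
    assume "fin_pres_module R ?I"
    from fin_pres_module_fin_gen_kernel[OF this hom surj] show "fin_gen_module R (syzygy_module R a n)"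
      unfolding eq .
  next
    assume "fin_gen_module R (syzygy_module R a n)"
    then have "fin_gen_module R (?F\<lparr>carrier := {v \<in> carrier ?F. ring_comb R a v n = \<zero>\<^bsub>?I\<^esub>}\<rparr>)"
      unfolding eq .
    with hom surj ideal_module_module[OF I] show "fin_pres_module R ?I"
      unfolding fin_pres_module_def Let_def by blast
  qed
qed

end

locale local_cring = cring R for R (structure) and \<mm> +
  assumes max_ideal: "ideal \<mm> R"
    and one_notin: "\<one> \<notin> \<mm>"
    and units: "x \<in> carrier R \<Longrightarrow> x \<notin> \<mm> \<Longrightarrow> x \<in> Units R"
begin

lemma max_ideal_carrier: "x \<in> \<mm> \<Longrightarrow> x \<in> carrier R"
  by (rule ideal.Icarr[OF max_ideal])

lemma proper_ideal_subset:
  assumes "ideal I R" "I \<noteq> carrier R"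
  shows "I \<subseteq> \<mm>"
proof
  interpret I: ideal I R by (rule assms)
  fix x assume x: "x \<in> I"
  show "x \<in> \<mm>"
  proof (rule ccontr)
    assume "x \<notin> \<mm>"
    then have "x \<in> Units R" using units I.Icarr x by blast
    then have "inv x \<otimes> x = \<one>" "inv x \<in> carrier R" by auto
    then have "\<one> \<in> I" using I.I_l_closed[OF x] by metis
    then show False using I.one_imp_carrier assms(2) by blast
  qed
qed

lemma minimal_generators:
  assumes I: "ideal I R" and fg: "fin_gen_module R (ideal_module R I)"
  obtains n a where "\<And>i. i < n \<Longrightarrow> a i \<in> I" "gen_ideal R a n = I"
    "\<And>r i. r \<in> syzygies R a n \<Longrightarrow> i < n \<Longrightarrow> r i \<in> \<mm>"
proof -
  let ?N = "ideal_module R I"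
  interpret I: ideal I R by (rule I)
  interpret N: module R ?N by (rule ideal_module_module[OF I])
  define G where "G = (\<lambda>S. finite S \<and> S \<subseteq> I \<and> N.span S = I)"
  obtain S0 where "G S0" using fg unfolding fin_gen_module_def G_def by auto
  from ex_has_least_nat[of G S0 card, OF this]
  obtain S where S: "G S" and least: "\<And>T. G T \<Longrightarrow> card S \<le> card T" by blast
  then have fin: "finite S" and SI: "S \<subseteq> I" and sp: "N.span S = I" unfolding G_def by auto
  obtain a where a: "bij_betw a {..<card S} S"
    using ex_bij_betw_nat_finite[OF fin] by (auto simp: atLeast0LessThan)
  let ?n = "card S"
  have aS: "a i \<in> S" if "i < ?n" for i using a that by (auto simp: bij_betw_def)
  then have aI: "a i \<in> I" if "i < ?n" for i using SI that by auto
  have aR: "a i \<in> carrier R" if "i < ?n" for i using aI[OF that] I.Icarr by blast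
  have gen: "gen_ideal R a ?n = I"
  proof
    show "gen_ideal R a ?n \<subseteq> I" by (rule gen_ideal_minimal[OF I, of ?n a, OF aI])
    interpret h: mod_hom R "free_module R ?n" ?N "\<lambda>r. ring_comb R a r ?n"
      by (intro mod_hom.intro mod_hom_axioms.intro func_space_is_module
          N.module_axioms ring_comb_hom[OF I, of ?n a, OF aI])
    have sub: "submodule R (gen_ideal R a ?n) ?N"
      using h.im_is_submodule by (simp add: h.im_def gen_ideal_def)
    have "a j \<in> gen_ideal R a ?n" if "j < ?n" for j
      using aR that by (rule generator_in_gen_ideal)
    then have "a ` {..<?n} \<subseteq> gen_ideal R a ?n" by blast
    then have "S \<subseteq> gen_ideal R a ?n" using a by (metis bij_betw_imp_surj_on)
    then show "I \<subseteq> gen_ideal R a ?n" using N.span_is_subset[OF _ sub] sp by blast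
  qed
  have "r j \<in> \<mm>" if r: "r \<in> syzygies R a ?n" and j: "j < ?n" for r j
  proof (rule ccontr)
    assume nm: "r j \<notin> \<mm>"
    have rc: "r i \<in> carrier R" if "i < ?n" for i
      using r that by (auto simp: syzygies_def)
    let ?T = "S - {a j}"
    have T: "?T \<subseteq> carrier ?N" using SI by auto
    note H = N.span_is_submodule[OF T]
    have "a i \<in> N.span ?T" if "i < ?n" "i \<noteq> j" for i
    proof -
      have "a i \<noteq> a j" using a that j by (auto simp: bij_betw_def inj_on_def)
      then show ?thesis using aS[OF that(1)] N.in_own_span[OF T] by auto
    qed
    moreover have "lin_comb ?N a r ?n \<in> N.span ?T"
      using r submodule.zero_closed[OF H] by (simp add: lin_comb_ideal_module syzygies_def)
    ultimately have "r j \<otimes> a j \<in> N.span ?T"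
      using N.lin_comb_coeff_in_submodule[OF H, of ?n r a j] rc aI j by simp
    moreover have u: "r j \<in> Units R" using units rc j nm by blast
    ultimately have "inv (r j) \<otimes> (r j \<otimes> a j) \<in> N.span ?T"
      using submodule.smult_closed[OF H, of "inv (r j)"] by auto
    then have aj: "a j \<in> N.span ?T"
      using u rc[OF j] aR[OF j] by (simp add: m_assoc[symmetric])
    have "S \<subseteq> N.span ?T" using aj N.in_own_span[OF T] by auto
    then have "I \<subseteq> N.span ?T" using N.span_is_subset[OF _ H] sp by blast
    then have "G ?T" unfolding G_def using fin SI N.span_is_subset2[OF T] by auto
    then have "card S \<le> card ?T" by (rule least)
    moreover have "card ?T < card S" using fin aS[OF j] by (intro psubset_card_mono) auto
    ultimately show False by simp
  qed
  then show ?thesis using that[of ?n a] aI gen by blast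
qed

end

text \<open>Krull's theorem, applied to a principal ideal.\<close>

lemma local_ring_local_cring:
  assumes "local_ring A M"
  shows "local_cring A M"
proof -
  interpret A: local_ring A M by (rule assms)
  interpret M: maximalideal M A by (rule A.maximal)
  show ?thesis
  proof (intro local_cring.intro local_cring_axioms.intro A.is_cring M.is_ideal)
    show "\<one>\<^bsub>A\<^esub> \<notin> M" using M.one_imp_carrier M.I_notcarr by blast
  next
    fix x assume x: "x \<in> carrier A" "x \<notin> M"
    show "x \<in> Units A"
    proof (rule ccontr)
      assume nu: "x \<notin> Units A"
      define \<I> where "\<I> = {I. ideal I A \<and> x \<in> I \<and> \<one>\<^bsub>A\<^esub> \<notin> I}"
      have "\<one>\<^bsub>A\<^esub> \<notin> PIdl\<^bsub>A\<^esub> x"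
      proof
        assume "\<one>\<^bsub>A\<^esub> \<in> PIdl\<^bsub>A\<^esub> x"
        then obtain y where "y \<in> carrier A" "\<one>\<^bsub>A\<^esub> = y \<otimes>\<^bsub>A\<^esub> x" unfolding cgenideal_def by auto
        then have "x \<in> Units A" using x(1) A.m_comm unfolding Units_def by auto
        then show False using nu by blast
      qed
      then have "PIdl\<^bsub>A\<^esub> x \<in> \<I>"
        using A.cgenideal_ideal A.cgenideal_self x(1) by (simp add: \<I>_def)
      then have ne: "\<I> \<noteq> {}" by blast
      have "\<exists>N\<in>\<I>. \<forall>X\<in>\<I>. N \<subseteq> X \<longrightarrow> X = N"
      proof (rule subset_Zorn_nonempty[OF ne])
        fix \<C> assume C: "\<C> \<noteq> {}" "subset.chain \<I> \<C>"
        then have CI: "\<And>I. I \<in> \<C> \<Longrightarrow> ideal I A \<and> x \<in> I \<and> \<one>\<^bsub>A\<^esub> \<notin> I"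
          and tot: "\<And>I J. I \<in> \<C> \<Longrightarrow> J \<in> \<C> \<Longrightarrow> I \<subseteq> J \<or> J \<subseteq> I"
          by (auto simp: subset.chain_def \<I>_def)
        have "ideal (\<Union>\<C>) A"
        proof (rule idealI)
          show "subgroup (\<Union>\<C>) (add_monoid A)"
          proof (rule A.add.subgroupI)
            show "\<Union>\<C> \<subseteq> carrier A"
            proof
              fix a assume "a \<in> \<Union>\<C>"
              then obtain I where "I \<in> \<C>" "a \<in> I" by blast
              then show "a \<in> carrier A" using CI ideal.Icarr[of I A a] by blast
            qed
            show "\<Union>\<C> \<noteq> {}" using C(1) CI by auto
            show "\<ominus>\<^bsub>A\<^esub> a \<in> \<Union>\<C>" if a: "a \<in> \<Union>\<C>" for a
            proof -
              from a obtain I where I: "I \<in> \<C>" "a \<in> I" by blast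
              then have "ideal I A" using CI by blast
              from additive_subgroup.a_inv_closed[OF ideal.axioms(1)[OF this] I(2)]
              show ?thesis using I(1) by blast
            qed
            fix a b assume "a \<in> \<Union>\<C>" "b \<in> \<Union>\<C>"
            then obtain I J where IJ: "I \<in> \<C>" "J \<in> \<C>" "a \<in> I" "b \<in> J" by blast
            then obtain K where K: "K \<in> \<C>" "a \<in> K" "b \<in> K" using tot[OF IJ(1,2)] by blast
            then have "ideal K A" using CI by blast
            from additive_subgroup.a_closed[OF ideal.axioms(1)[OF this] K(2,3)]
            show "a \<oplus>\<^bsub>A\<^esub> b \<in> \<Union>\<C>" using K(1) by blast
          qed
        next
          fix a y assume "a \<in> \<Union>\<C>" and y: "y \<in> carrier A"
          then obtain I where I: "I \<in> \<C>" "a \<in> I" by blast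
          then have "ideal I A" using CI by blast
          from ideal.I_l_closed[OF this I(2) y] ideal.I_r_closed[OF this I(2) y]
          show "y \<otimes>\<^bsub>A\<^esub> a \<in> \<Union>\<C>" "a \<otimes>\<^bsub>A\<^esub> y \<in> \<Union>\<C>" using I(1) by blast+
        qed (rule A.ring_axioms)
        then show "\<Union>\<C> \<in> \<I>" using C(1) CI unfolding \<I>_def by blast
      qed
      then obtain N where N: "ideal N A" "x \<in> N" "\<one>\<^bsub>A\<^esub> \<notin> N"
        and max: "\<And>X. ideal X A \<Longrightarrow> x \<in> X \<Longrightarrow> \<one>\<^bsub>A\<^esub> \<notin> X \<Longrightarrow> N \<subseteq> X \<Longrightarrow> X = N"
        unfolding \<I>_def by blast
      have "maximalideal N A"
      proof (rule maximalidealI[OF N(1)])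
        show "carrier A \<noteq> N" using N(3) by auto
        fix J assume J: "ideal J A" "N \<subseteq> J"
        show "J = N \<or> J = carrier A"
          using max[OF J(1) _ _ J(2)] N(2) J(2) ideal.one_imp_carrier[OF J(1)] by auto
      qed
      then show False using A.unique N(2) x(2) by blast
    qed
  qed
qed

section \<open>Syzygies with entries in the maximal ideal\<close>

definition max_syzygy_module ::
    "('a, 'm) ring_scheme \<Rightarrow> 'a set \<Rightarrow> (nat \<Rightarrow> 'a) \<Rightarrow> nat \<Rightarrow> ('a, nat \<Rightarrow> 'a) module"
  where "max_syzygy_module R \<mm> a n =
    (free_module R n)\<lparr>carrier := {r \<in> syzygies R a n. \<forall>i<n. r i \<in> \<mm>}\<rparr>"

context local_cring begin

lemma functional_kernel_submodule:
  assumes N: "module R N" and f: "f \<in> module_hom R N (ideal_module R (carrier R))"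
  shows "submodule R {x \<in> carrier N. f x \<in> \<mm>} N"
proof -
  interpret N: module R N by (rule N)
  interpret f: mod_hom R N "ideal_module R (carrier R)" f
    by (intro mod_hom.intro mod_hom_axioms.intro N ring_as_module f)
  interpret I: ideal \<mm> R by (rule max_ideal)
  show ?thesis
    by (rule submodule.intro) (use N f.f0_is_0 I.I_l_closed in auto)
qed

lemma functional_split:
  assumes N: "module R N" and f: "f \<in> module_hom R N (ideal_module R (carrier R))"
    and x: "x \<in> carrier N" "f x \<notin> \<mm>"
  obtains s where "s \<in> carrier N" "f s = \<one>"
proof -
  interpret N: module R N by (rule N)
  interpret f: mod_hom R N "ideal_module R (carrier R)" f
    by (intro mod_hom.intro mod_hom_axioms.intro N ring_as_module f)
  have "f x \<in> Units R" using f.f_im[OF x(1)] x(2) by (intro units) simp_all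
  then have "inv (f x) \<odot>\<^bsub>N\<^esub> x \<in> carrier N" "f (inv (f x) \<odot>\<^bsub>N\<^esub> x) = \<one>" using x(1) by auto
  then show ?thesis by (rule that)
qed

lemma fin_gen_from_functional:
  assumes N: "module R N" and f: "f \<in> module_hom R N (ideal_module R (carrier R))"
    and fg: "fin_gen_module R (N\<lparr>carrier := {x \<in> carrier N. f x \<in> \<mm>}\<rparr>)"
  shows "fin_gen_module R N"
proof (cases "\<forall>x\<in>carrier N. f x \<in> \<mm>")
  case True
  then have "{x \<in> carrier N. f x \<in> \<mm>} = carrier N" by auto
  then show ?thesis using fg by simp
next
  case False
  then obtain s where s: "s \<in> carrier N" "f s = \<one>" using functional_split[OF N f] by metis
  interpret N: module R N by (rule N)
  interpret f: mod_hom R N "ideal_module R (carrier R)" f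
    by (intro mod_hom.intro mod_hom_axioms.intro N ring_as_module f)
  let ?K = "N\<lparr>carrier := {x \<in> carrier N. f x \<in> \<mm>}\<rparr>"
  have "fin_spanned R N ((\<lambda>x. x) ` carrier ?K)"
    by (rule fin_spanned_semilinear_image[OF fg N, where \<sigma> = "\<lambda>r. r"]) auto
  moreover have "fin_spanned R N ((\<lambda>c. c \<odot>\<^bsub>N\<^esub> s) ` carrier R)"
    unfolding fin_spanned_def
    using s(1) N.in_own_span[of "{s}"] by (intro exI[of _ "{s}"]) (auto intro!: N.span_closed_smult)
  moreover have "\<exists>x\<in>(\<lambda>x. x) ` carrier ?K. \<exists>y\<in>(\<lambda>c. c \<odot>\<^bsub>N\<^esub> s) ` carrier R. z = x \<oplus>\<^bsub>N\<^esub> y"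
    if z: "z \<in> carrier N" for z
  proof -
    have fz: "f z \<in> carrier R" using f.f_im[OF z] by simp
    let ?y = "f z \<odot>\<^bsub>N\<^esub> s"
    have y: "?y \<in> carrier N" "f ?y = f z" using s fz by simp_all
    have "f (z \<ominus>\<^bsub>N\<^esub> ?y) = \<zero>"
      using f.f_minus[OF z y(1)] f.f_im[OF z] f.N.M.r_neg[of "f z"] y(2) by (simp add: a_minus_def)
    then have "z \<ominus>\<^bsub>N\<^esub> ?y \<in> carrier ?K"
      using z y ideal.axioms(1)[OF max_ideal] by (simp add: additive_subgroup.zero_closed)
    moreover have "z = (z \<ominus>\<^bsub>N\<^esub> ?y) \<oplus>\<^bsub>N\<^esub> ?y"
      using z y(1) by (simp add: N.M.minus_eq N.M.a_assoc N.M.l_neg)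
    ultimately show ?thesis using fz by blast
  qed
  ultimately show ?thesis unfolding fin_gen_module_iff using N N.fin_spanned_add by blast
qed

lemma fin_gen_functional_restrict:
  assumes f: "f \<in> module_hom R N (ideal_module R (carrier R))"
    and fg: "fin_gen_module R N" and fgm: "fin_gen_module R (ideal_module R \<mm>)"
  shows "fin_gen_module R (N\<lparr>carrier := {x \<in> carrier N. f x \<in> \<mm>}\<rparr>)"
proof (cases "\<forall>x\<in>carrier N. f x \<in> \<mm>")
  case True
  then have "{x \<in> carrier N. f x \<in> \<mm>} = carrier N" by auto
  then show ?thesis using fg by simp
next
  case False
  have N: "module R N" using fg by (simp add: fin_gen_module_def)
  from False obtain s where s: "s \<in> carrier N" "f s = \<one>" using functional_split[OF N f] by metis
  interpret N: module R N by (rule N)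
  interpret f: mod_hom R N "ideal_module R (carrier R)" f
    by (intro mod_hom.intro mod_hom_axioms.intro N ring_as_module f)
  let ?K = "N\<lparr>carrier := {x \<in> carrier N. f x \<in> \<mm>}\<rparr>"
  have K: "module R ?K" by (rule N.submodule_is_module[OF functional_kernel_submodule[OF N f]])
  interpret K: module R ?K by (rule K)
  let ?p = "\<lambda>z. z \<ominus>\<^bsub>N\<^esub> f z \<odot>\<^bsub>N\<^esub> s"
  have fz: "f z \<in> carrier R" if "z \<in> carrier N" for z using f.f_im[OF that] by simp
  have p: "?p z \<in> carrier ?K" if z: "z \<in> carrier N" for z
  proof -
    let ?y = "f z \<odot>\<^bsub>N\<^esub> s"
    have y: "?y \<in> carrier N" "f ?y = f z" using s fz[OF z] by simp_all
    have "f (z \<ominus>\<^bsub>N\<^esub> ?y) = \<zero>"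
      using f.f_minus[OF z y(1)] f.f_im[OF z] f.N.M.r_neg[of "f z"] y(2) by (simp add: a_minus_def)
    then show ?thesis
      using z y ideal.axioms(1)[OF max_ideal] by (simp add: additive_subgroup.zero_closed)
  qed
  have "fin_spanned R ?K (?p ` carrier N)"
  proof (rule fin_spanned_semilinear_image[OF fg K, where \<sigma> = "\<lambda>r. r"])
    show "?p \<in> carrier N \<rightarrow> carrier ?K" using p by blast
    fix x y assume "x \<in> carrier N" "y \<in> carrier N"
    then show "?p (x \<oplus>\<^bsub>N\<^esub> y) = ?p x \<oplus>\<^bsub>?K\<^esub> ?p y"
      using fz s(1) by (simp add: N.M.minus_eq N.M.minus_add N.smult_l_distr N.M.a_ac)
  next
    fix r x assume "r \<in> carrier R" "x \<in> carrier N"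
    then show "?p (r \<odot>\<^bsub>N\<^esub> x) = r \<odot>\<^bsub>?K\<^esub> ?p x"
      using fz s(1) by (simp add: N.M.minus_eq N.smult_r_distr N.smult_r_minus N.smult_assoc1)
  qed simp
  moreover have "fin_spanned R ?K ((\<lambda>c. c \<odot>\<^bsub>N\<^esub> s) ` carrier (ideal_module R \<mm>))"
  proof (rule fin_spanned_semilinear_image[OF fgm K, where \<sigma> = "\<lambda>r. r"])
    have "f (c \<odot>\<^bsub>N\<^esub> s) = c" if "c \<in> carrier R" for c using s that by simp
    then show "(\<lambda>c. c \<odot>\<^bsub>N\<^esub> s) \<in> carrier (ideal_module R \<mm>) \<rightarrow> carrier ?K"
      using s(1) max_ideal_carrier by simp
  qed (use s(1) max_ideal_carrier in \<open>simp_all add: N.smult_l_distr N.smult_assoc1\<close>)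
  moreover have "\<exists>x\<in>?p ` carrier N. \<exists>y\<in>(\<lambda>c. c \<odot>\<^bsub>N\<^esub> s) ` carrier (ideal_module R \<mm>). z = x \<oplus>\<^bsub>?K\<^esub> y"
    if "z \<in> carrier ?K" for z
  proof -
    have z: "z \<in> carrier N" "f z \<in> \<mm>" using that by auto
    then have "?p z \<oplus>\<^bsub>?K\<^esub> f z \<odot>\<^bsub>N\<^esub> s = z"
      using s(1) fz by (simp add: N.M.minus_eq N.M.a_assoc N.M.l_neg)
    moreover have "f z \<odot>\<^bsub>N\<^esub> s \<in> (\<lambda>c. c \<odot>\<^bsub>N\<^esub> s) ` carrier (ideal_module R \<mm>)" using z(2) by simp
    ultimately show ?thesis using z(1) by (intro bexI[of _ "?p z"] bexI[of _ "f z \<odot>\<^bsub>N\<^esub> s"]) auto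
  qed
  ultimately have "fin_spanned R ?K (carrier ?K)" by (rule K.fin_spanned_add)
  then show ?thesis unfolding fin_gen_module_iff using K by blast
qed

lemma coordinate_hom:
  assumes "k < n" and H: "H \<subseteq> {..<n} \<rightarrow>\<^sub>E carrier R"
  shows "(\<lambda>r. r k) \<in> module_hom R ((free_module R n)\<lparr>carrier := H\<rparr>) (ideal_module R (carrier R))"
proof -
  have "r i \<in> carrier R" if "r \<in> H" "i < n" for r i using H that by auto
  then show ?thesis using assms(1) by (simp add: module_hom_def)
qed

lemma max_coords_submodule:
  assumes "submodule R H (free_module R n)" "k \<le> n"
  shows "submodule R {r \<in> H. \<forall>i<k. r i \<in> \<mm>} (free_module R n)"
proof (rule submodule.intro)
  interpret H: submodule R H "free_module R n" by (rule assms)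
  interpret I: ideal \<mm> R by (rule max_ideal)
  have lt: "i < n" if "i < k" for i using that assms(2) by simp
  show "module R (free_module R n)" by (rule func_space_is_module)
  show "{r \<in> H. \<forall>i<k. r i \<in> \<mm>} \<subseteq> carrier (free_module R n)" using H.subset by auto
  show "\<zero>\<^bsub>free_module R n\<^esub> \<in> {r \<in> H. \<forall>i<k. r i \<in> \<mm>}"
    using H.zero_closed lt I.zero_closed by (simp del: H.zero_closed)
  show "v \<oplus>\<^bsub>free_module R n\<^esub> w \<in> {r \<in> H. \<forall>i<k. r i \<in> \<mm>}"
    if "v \<in> {r \<in> H. \<forall>i<k. r i \<in> \<mm>}" "w \<in> {r \<in> H. \<forall>i<k. r i \<in> \<mm>}" for v w
    using that H.m_closed[of v w] lt I.a_closed by (simp del: H.m_closed)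
  show "c \<odot>\<^bsub>free_module R n\<^esub> v \<in> {r \<in> H. \<forall>i<k. r i \<in> \<mm>}"
    if "c \<in> carrier R" "v \<in> {r \<in> H. \<forall>i<k. r i \<in> \<mm>}" for c v
    using that H.smult_closed[of c v] lt I.I_l_closed by (simp del: H.smult_closed)
qed

lemma max_coords_Suc:
  "N\<lparr>carrier := {r \<in> H. \<forall>i<Suc k. r i \<in> \<mm>}\<rparr> =
    N\<lparr>carrier := {r \<in> H. \<forall>i<k. r i \<in> \<mm>}\<rparr>\<lparr>carrier :=
      {x \<in> carrier (N\<lparr>carrier := {r \<in> H. \<forall>i<k. r i \<in> \<mm>}\<rparr>). x k \<in> \<mm>}\<rparr>"
proof -
  have "{r \<in> H. \<forall>i<Suc k. r i \<in> \<mm>} = {x \<in> {r \<in> H. \<forall>i<k. r i \<in> \<mm>}. x k \<in> \<mm>}"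
    by (auto simp: less_Suc_eq)
  then show ?thesis by simp
qed

lemma fin_gen_from_max_coords:
  assumes H: "submodule R H (free_module R n)"
    and fg: "fin_gen_module R ((free_module R n)\<lparr>carrier := {r \<in> H. \<forall>i<n. r i \<in> \<mm>}\<rparr>)"
  shows "fin_gen_module R ((free_module R n)\<lparr>carrier := H\<rparr>)"
proof -
  let ?W = "\<lambda>k. (free_module R n)\<lparr>carrier := {r \<in> H. \<forall>i<k. r i \<in> \<mm>}\<rparr>"
  have Hs: "H \<subseteq> {..<n} \<rightarrow>\<^sub>E carrier R" using submodule.subset[OF H] by simp
  have "fin_gen_module R (?W 0)" if "fin_gen_module R (?W k)" "k \<le> n" for k
    using that
  proof (induction k)
    case (Suc k)
    have W: "module R (?W k)"
      using Suc.prems(2) by (intro module.submodule_is_module[OF func_space_is_module] max_coords_submodule H) simp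
    have "(\<lambda>r. r k) \<in> module_hom R (?W k) (ideal_module R (carrier R))"
      using Suc.prems(2) Hs by (intro coordinate_hom) auto
    from fin_gen_from_functional[OF W this] Suc.prems(1) have "fin_gen_module R (?W k)"
      unfolding max_coords_Suc by blast
    then show ?case using Suc by simp
  qed
  from this[of n] fg show ?thesis by simp
qed

lemma fin_gen_max_coords:
  assumes H: "submodule R H (free_module R n)"
    and fg: "fin_gen_module R ((free_module R n)\<lparr>carrier := H\<rparr>)"
    and fgm: "fin_gen_module R (ideal_module R \<mm>)"
  shows "fin_gen_module R ((free_module R n)\<lparr>carrier := {r \<in> H. \<forall>i<n. r i \<in> \<mm>}\<rparr>)"
proof -
  let ?W = "\<lambda>k. (free_module R n)\<lparr>carrier := {r \<in> H. \<forall>i<k. r i \<in> \<mm>}\<rparr>"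
  have Hs: "H \<subseteq> {..<n} \<rightarrow>\<^sub>E carrier R" using submodule.subset[OF H] by simp
  have "fin_gen_module R (?W k)" if "k \<le> n" for k
    using that
  proof (induction k)
    case 0
    then show ?case using fg by simp
  next
    case (Suc k)
    have "(\<lambda>r. r k) \<in> module_hom R (?W k) (ideal_module R (carrier R))"
      using Suc.prems Hs by (intro coordinate_hom) auto
    from fin_gen_functional_restrict[OF this _ fgm] Suc show ?case
      unfolding max_coords_Suc by simp
  qed
  then show ?thesis by simp
qed

lemma fin_gen_max_ideal:
  assumes a: "\<And>i. i < n \<Longrightarrow> a i \<in> carrier R"
    and s: "s \<in> syzygies R a n" "j < n" "s j \<notin> \<mm>"
    and fg: "fin_gen_module R (max_syzygy_module R \<mm> a n)"
  shows "fin_gen_module R (ideal_module R \<mm>)"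
proof (rule fin_gen_hom_image[OF fg ideal_module_module[OF max_ideal]])
  interpret I: ideal \<mm> R by (rule max_ideal)
  have H: "submodule R (syzygies R a n) (free_module R n)" using a by (rule syzygies_submodule)
  have sj: "s j \<in> carrier R" using s by (auto simp: syzygies_def)
  then have u: "s j \<in> Units R" using units s by blast
  let ?f = "\<lambda>r. inv (s j) \<otimes> r j"
  show "?f \<in> module_hom R (max_syzygy_module R \<mm> a n) (ideal_module R \<mm>)"
    using s(2) u I.Icarr
    by (simp add: module_hom_def max_syzygy_module_def I.I_l_closed r_distr m_lcomm)
  show "carrier (ideal_module R \<mm>) \<subseteq> ?f ` carrier (max_syzygy_module R \<mm> a n)"
  proof
    fix m assume "m \<in> carrier (ideal_module R \<mm>)"
    then have m: "m \<in> \<mm>" "m \<in> carrier R" using I.Icarr by auto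
    have sc: "s i \<in> carrier R" if "i < n" for i using s(1) that by (auto simp: syzygies_def)
    have "m \<odot>\<^bsub>free_module R n\<^esub> s \<in> syzygies R a n"
      using submodule.smult_closed[OF H m(2) s(1)] .
    then have "m \<odot>\<^bsub>free_module R n\<^esub> s \<in> carrier (max_syzygy_module R \<mm> a n)"
      using m(1) sc by (simp add: max_syzygy_module_def I.I_r_closed)
    moreover have "m = ?f (m \<odot>\<^bsub>free_module R n\<^esub> s)"
      using u sj s(2) m(2) by (simp add: m_lcomm[of _ m])
    ultimately show "m \<in> ?f ` carrier (max_syzygy_module R \<mm> a n)" by (rule rev_image_eqI[where f = ?f])
  qed
qed

end

section \<open>Syzygies over the trivial extension\<close>

locale trivial_ext =
  fixes A :: "('a, 'm) ring_scheme" and M :: "'a set" and E :: "('a, 'b, 'n) module_scheme"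
  assumes local: "local_cring A M" and mod_E: "module A E"
    and annihilates: "\<And>m e. m \<in> M \<Longrightarrow> e \<in> carrier E \<Longrightarrow> m \<odot>\<^bsub>E\<^esub> e = \<zero>\<^bsub>E\<^esub>"
begin

sublocale A: local_cring A M by (rule local)
sublocale E: module A E by (rule mod_E)

abbreviation "R \<equiv> A \<propto> E"

lemma ext_simps [simp]:
  "carrier R = carrier A \<times> carrier E"
  "\<one>\<^bsub>R\<^esub> = (\<one>\<^bsub>A\<^esub>, \<zero>\<^bsub>E\<^esub>)"
  "\<zero>\<^bsub>R\<^esub> = (\<zero>\<^bsub>A\<^esub>, \<zero>\<^bsub>E\<^esub>)"
  "x \<otimes>\<^bsub>R\<^esub> y = (fst x \<otimes>\<^bsub>A\<^esub> fst y, fst x \<odot>\<^bsub>E\<^esub> snd y \<oplus>\<^bsub>E\<^esub> fst y \<odot>\<^bsub>E\<^esub> snd x)"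
  "x \<oplus>\<^bsub>R\<^esub> y = (fst x \<oplus>\<^bsub>A\<^esub> fst y, snd x \<oplus>\<^bsub>E\<^esub> snd y)"
  by (simp_all add: trivial_extension_def case_prod_beta)

lemma cring_ext: "cring R"
proof (rule cringI)
  show "abelian_group R"
  proof (rule abelian_groupI)
    show "\<exists>y\<in>carrier R. y \<oplus>\<^bsub>R\<^esub> x = \<zero>\<^bsub>R\<^esub>" if "x \<in> carrier R" for x
      using that by (intro bexI[of _ "(\<ominus>\<^bsub>A\<^esub> fst x, \<ominus>\<^bsub>E\<^esub> snd x)"]) (auto simp: A.l_neg E.M.l_neg)
  qed (auto simp: A.a_ac E.M.a_ac)
  show "comm_monoid R"
    by (rule comm_monoidI)
      (auto simp: A.m_ac E.M.a_ac E.smult_r_distr E.smult_assoc1[symmetric])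
qed (auto simp: A.l_distr E.smult_l_distr E.smult_r_distr E.M.a_ac)

sublocale R: cring R by (rule cring_ext)

declare annihilates [simp]

lemma ext_unit:
  assumes "x \<in> carrier R" "fst x \<in> Units A"
  shows "x \<in> Units R"
proof -
  obtain a e where x: "x = (a, e)" by (cases x)
  then have a: "a \<in> Units A" "a \<in> carrier A" and e: "e \<in> carrier E" using assms by auto
  let ?b = "inv\<^bsub>A\<^esub> a"
  let ?y = "(?b, \<ominus>\<^bsub>E\<^esub> (?b \<odot>\<^bsub>E\<^esub> (?b \<odot>\<^bsub>E\<^esub> e)))"
  have b: "?b \<in> carrier A" using a by simp
  have "a \<odot>\<^bsub>E\<^esub> (\<ominus>\<^bsub>E\<^esub> (?b \<odot>\<^bsub>E\<^esub> (?b \<odot>\<^bsub>E\<^esub> e))) = \<ominus>\<^bsub>E\<^esub> ((a \<otimes>\<^bsub>A\<^esub> ?b) \<odot>\<^bsub>E\<^esub> (?b \<odot>\<^bsub>E\<^esub> e))"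
    using a(2) b e by (simp only: E.smult_r_minus E.smult_assoc1 E.smult_closed)
  also have "\<dots> = \<ominus>\<^bsub>E\<^esub> (?b \<odot>\<^bsub>E\<^esub> e)" using a b e by simp
  finally have eq: "a \<odot>\<^bsub>E\<^esub> (\<ominus>\<^bsub>E\<^esub> (?b \<odot>\<^bsub>E\<^esub> (?b \<odot>\<^bsub>E\<^esub> e))) = \<ominus>\<^bsub>E\<^esub> (?b \<odot>\<^bsub>E\<^esub> e)" .
  have "?y \<otimes>\<^bsub>R\<^esub> x = \<one>\<^bsub>R\<^esub>" "x \<otimes>\<^bsub>R\<^esub> ?y = \<one>\<^bsub>R\<^esub>"
    using a b e by (simp_all add: x eq E.M.r_neg E.M.l_neg)
  moreover have "?y \<in> carrier R" using b e by simp
  ultimately show ?thesis using assms(1) unfolding Units_def by blast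
qed

lemma local_ext: "local_cring R (M \<times> carrier E)"
proof (intro local_cring.intro local_cring_axioms.intro cring_ext)
  interpret I: ideal M A by (rule A.max_ideal)
  have neg: "\<ominus>\<^bsub>R\<^esub> x = (\<ominus>\<^bsub>A\<^esub> fst x, \<ominus>\<^bsub>E\<^esub> snd x)" if "x \<in> carrier R" for x
    using that by (intro R.minus_equality) (auto simp: A.l_neg E.M.l_neg)
  show "ideal (M \<times> carrier E) R"
  proof (rule idealI)
    show "subgroup (M \<times> carrier E) (add_monoid R)"
    proof (rule R.add.subgroupI)
      show "M \<times> carrier E \<noteq> {}" using I.zero_closed E.M.zero_closed by blast
      show "\<ominus>\<^bsub>R\<^esub> x \<in> M \<times> carrier E" if "x \<in> M \<times> carrier E" for x
      proof -
        have "x \<in> carrier R" using that I.Icarr by auto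
        then show ?thesis using that by (auto simp: neg)
      qed
    qed (use I.Icarr in auto)
  qed (use I.Icarr in \<open>auto intro: R.ring_axioms I.I_l_closed I.I_r_closed\<close>)
  show "\<one>\<^bsub>R\<^esub> \<notin> M \<times> carrier E" using A.one_notin by simp
  show "x \<in> Units R" if "x \<in> carrier R" "x \<notin> M \<times> carrier E" for x
    using that by (intro ext_unit A.units) auto
qed

sublocale R: local_cring R "M \<times> carrier E" by (rule local_ext)

lemma ring_comb_ext:
  assumes "\<And>i. i < n \<Longrightarrow> w i \<in> carrier R" "\<And>i. i < n \<Longrightarrow> c i \<in> M \<times> carrier E"
  shows "ring_comb R c w n =
    (ring_comb A (\<lambda>i. fst (c i)) (\<lambda>i. fst (w i)) n, lin_comb E (\<lambda>i. snd (c i)) (\<lambda>i. fst (w i)) n)"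
  using assms
proof (induction n)
  case (Suc n)
  have "w n \<in> carrier R" "c n \<in> M \<times> carrier E" using Suc.prems by blast+
  then have "fst (w n) \<in> carrier A" "snd (w n) \<in> carrier E" "fst (c n) \<in> M" "snd (c n) \<in> carrier E"
    by auto
  moreover have "lin_comb E (\<lambda>i. snd (c i)) (\<lambda>i. fst (w i)) n \<in> carrier E"
  proof (rule E.lin_comb_closed)
    fix i assume "i < n"
    then have "w i \<in> carrier R" "c i \<in> M \<times> carrier E" using Suc.prems by auto
    then show "fst (w i) \<in> carrier A" "snd (c i) \<in> carrier E" by auto
  qed
  ultimately show ?case using Suc by auto
qed simp

context
  fixes c :: "nat \<Rightarrow> 'a \<times> 'b" and n :: nat
  assumes c: "\<And>i. i < n \<Longrightarrow> c i \<in> M \<times> carrier E"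
    and minimal: "\<And>w i. w \<in> syzygies R c n \<Longrightarrow> i < n \<Longrightarrow> w i \<in> M \<times> carrier E"
begin

abbreviation "U \<equiv> max_syzygy_module A M (\<lambda>i. fst (c i)) n"
abbreviation "K \<equiv> syzygy_module R c n"

lemma mem_U: "u \<in> carrier U \<longleftrightarrow> u \<in> {..<n} \<rightarrow>\<^sub>E carrier A \<and> (\<forall>i<n. u i \<in> M) \<and>
    ring_comb A (\<lambda>i. fst (c i)) u n = \<zero>\<^bsub>A\<^esub>"
  by (auto simp: max_syzygy_module_def syzygies_def)

lemma mem_K: "w \<in> carrier K \<longleftrightarrow> w \<in> {..<n} \<rightarrow>\<^sub>E carrier R \<and> (\<forall>i<n. fst (w i) \<in> M) \<and>
    ring_comb A (\<lambda>i. fst (c i)) (\<lambda>i. fst (w i)) n = \<zero>\<^bsub>A\<^esub>"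
proof -
  have cE: "snd (c i) \<in> carrier E" if "i < n" for i using c[OF that] by auto
  have wR: "w i \<in> carrier R" if "w \<in> {..<n} \<rightarrow>\<^sub>E carrier R" "i < n" for i using that by blast
  have "lin_comb E (\<lambda>i. snd (c i)) (\<lambda>i. fst (w i)) n = \<zero>\<^bsub>E\<^esub>" if "\<forall>i<n. fst (w i) \<in> M"
    using that cE by (intro E.lin_comb_eq_zero) simp
  moreover have "fst (w i) \<in> M" if "w \<in> syzygies R c n" "i < n" for i
    using minimal[OF that] by auto
  ultimately show ?thesis
    using ring_comb_ext[OF wR c]
    by (auto simp: syzygy_module_def syzygies_def simp del: ext_simps(1))
qed

lemma K_module: "module R K"
proof (rule R.syzygy_module_module)
  show "c i \<in> carrier R" if "i < n" for i using c[OF that] A.max_ideal_carrier by auto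
qed

lemma U_module: "module A U"
  unfolding max_syzygy_module_def
proof (intro module.submodule_is_module[OF A.func_space_is_module] A.max_coords_submodule
    A.syzygies_submodule order.refl)
  show "fst (c i) \<in> carrier A" if "i < n" for i using c[OF that] A.max_ideal_carrier by auto
qed

lemma K_simps:
  "w \<oplus>\<^bsub>K\<^esub> z = (\<lambda>i\<in>{..<n}. w i \<oplus>\<^bsub>R\<^esub> z i)"
  "r \<odot>\<^bsub>K\<^esub> w = (\<lambda>i\<in>{..<n}. r \<otimes>\<^bsub>R\<^esub> w i)"
  by (simp_all add: syzygy_module_def del: ext_simps)

lemma U_simps:
  "w \<oplus>\<^bsub>U\<^esub> z = (\<lambda>i\<in>{..<n}. w i \<oplus>\<^bsub>A\<^esub> z i)"
  "r \<odot>\<^bsub>U\<^esub> w = (\<lambda>i\<in>{..<n}. r \<otimes>\<^bsub>A\<^esub> w i)"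
  by (simp_all add: max_syzygy_module_def)

lemma K_coord:
  assumes "w \<in> carrier K" "i < n"
  shows "fst (w i) \<in> M" "fst (w i) \<in> carrier A" "snd (w i) \<in> carrier E"
proof -
  have "w i \<in> carrier R" using assms mem_K by blast
  then show "fst (w i) \<in> carrier A" "snd (w i) \<in> carrier E" by auto
  show "fst (w i) \<in> M" using assms mem_K by blast
qed

lemma fin_gen_U:
  assumes fg: "fin_gen_module R K"
  shows "fin_gen_module A U"
proof (rule fin_gen_semilinear_image[OF fg U_module, where h = "\<lambda>w. \<lambda>i\<in>{..<n}. fst (w i)" and \<sigma> = fst])
  let ?h = "\<lambda>w. \<lambda>i\<in>{..<n}. fst (w i)"
  show "?h \<in> carrier K \<rightarrow> carrier U"
  proof
    fix w assume w: "w \<in> carrier K"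
    have "ring_comb A (\<lambda>i. fst (c i)) (?h w) n = ring_comb A (\<lambda>i. fst (c i)) (\<lambda>i. fst (w i)) n"
      by (rule A.ring_comb_cong) simp_all
    then show "?h w \<in> carrier U" using w K_coord[OF w] by (auto simp: mem_U mem_K)
  qed
  show "carrier U \<subseteq> ?h ` carrier K"
  proof
    fix u assume u: "u \<in> carrier U"
    let ?w = "\<lambda>i\<in>{..<n}. (u i, \<zero>\<^bsub>E\<^esub>)"
    have "ring_comb A (\<lambda>i. fst (c i)) (\<lambda>i. fst (?w i)) n = ring_comb A (\<lambda>i. fst (c i)) u n"
      by (rule A.ring_comb_cong) simp_all
    then have "?w \<in> carrier K" using u by (auto simp: mem_U mem_K)
    moreover have "u = ?h ?w" using u by (intro extensionalityI[of _ "{..<n}"]) (auto simp: mem_U PiE_iff)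
    ultimately show "u \<in> ?h ` carrier K" by (rule rev_image_eqI[where f = ?h])
  qed
qed (auto simp: K_simps U_simps)

lemma fin_gen_E:
  assumes fg: "fin_gen_module R K" and n: "0 < n"
  shows "fin_gen_module A E"
proof (rule fin_gen_semilinear_image[OF fg mod_E, where h = "\<lambda>w. snd (w 0)" and \<sigma> = fst])
  let ?h = "\<lambda>w::nat \<Rightarrow> 'a \<times> 'b. snd (w 0)"
  show "?h \<in> carrier K \<rightarrow> carrier E" using K_coord(3) n by blast
  show "carrier E \<subseteq> ?h ` carrier K"
  proof
    fix e assume e: "e \<in> carrier E"
    let ?w = "\<lambda>i\<in>{..<n}. (\<zero>\<^bsub>A\<^esub>, if i = 0 then e else \<zero>\<^bsub>E\<^esub>)"
    interpret I: ideal M A by (rule A.max_ideal)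
    have "ring_comb A (\<lambda>i. fst (c i)) (\<lambda>i. fst (?w i)) k = \<zero>\<^bsub>A\<^esub>" if "k \<le> n" for k
      using that c A.max_ideal_carrier by (induction k) (auto simp: Suc_le_eq mem_Times_iff)
    then have "?w \<in> carrier K" using e by (auto simp: mem_K)
    moreover have "e = ?h ?w" using n by simp
    ultimately show "e \<in> ?h ` carrier K" by (rule rev_image_eqI[where f = ?h])
  qed
next
  fix r w assume r: "r \<in> carrier R" and w: "w \<in> carrier K"
  show "snd ((r \<odot>\<^bsub>K\<^esub> w) 0) = fst r \<odot>\<^bsub>E\<^esub> snd (w 0)"
    using r K_coord[OF w n] n by (auto simp: K_simps)
qed (use n in \<open>auto simp: K_simps\<close>)

lemma fin_gen_K:
  assumes fgU: "fin_gen_module A U" and fgE: "fin_gen_module A E"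
  shows "fin_gen_module R K"
proof -
  interpret K: module R K by (rule K_module)
  interpret I: ideal M A by (rule A.max_ideal)
  have cA: "fst (c i) \<in> carrier A" if "i < n" for i using c[OF that] A.max_ideal_carrier by auto
  define X where "X k = {w \<in> carrier K. \<forall>i<n. k \<le> i \<longrightarrow> snd (w i) = \<zero>\<^bsub>E\<^esub>}" for k
  let ?u = "\<lambda>u. \<lambda>i\<in>{..<n}. (u i, \<zero>\<^bsub>E\<^esub>)"
  let ?e = "\<lambda>k e. \<lambda>i\<in>{..<n}. (\<zero>\<^bsub>A\<^esub>, if i = k then e else \<zero>\<^bsub>E\<^esub>)"
  have fsU: "fin_spanned R K (?u ` carrier U)"
  proof (rule fin_spanned_semilinear_image[OF fgU K_module, where \<sigma> = "\<lambda>a. (a, \<zero>\<^bsub>E\<^esub>)"])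
    show "?u \<in> carrier U \<rightarrow> carrier K"
    proof
      fix u assume u: "u \<in> carrier U"
      have "ring_comb A (\<lambda>i. fst (c i)) (\<lambda>i. fst (?u u i)) n = ring_comb A (\<lambda>i. fst (c i)) u n"
        by (rule A.ring_comb_cong) simp_all
      then show "?u u \<in> carrier K" using u by (auto simp: mem_U mem_K)
    qed
    fix a u assume "a \<in> carrier A" and u: "u \<in> carrier U"
    moreover have "u i \<in> M" if "i < n" for i using u that by (auto simp: mem_U)
    ultimately show "?u (a \<odot>\<^bsub>U\<^esub> u) = (a, \<zero>\<^bsub>E\<^esub>) \<odot>\<^bsub>K\<^esub> ?u u"
      using A.max_ideal_carrier by (auto simp: K_simps U_simps)
  qed (auto simp: K_simps U_simps)
  have fsE: "fin_spanned R K (?e k ` carrier E)" for k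
  proof (rule fin_spanned_semilinear_image[OF fgE K_module, where \<sigma> = "\<lambda>a. (a, \<zero>\<^bsub>E\<^esub>)"])
    show "?e k \<in> carrier E \<rightarrow> carrier K"
    proof
      fix e assume e: "e \<in> carrier E"
      have "ring_comb A (\<lambda>i. fst (c i)) (\<lambda>i. fst (?e k e i)) j = \<zero>\<^bsub>A\<^esub>" if "j \<le> n" for j
        using that cA by (induction j) (auto simp: Suc_le_eq)
      then show "?e k e \<in> carrier K" using e by (auto simp: mem_K)
    qed
  qed (auto simp: K_simps)
  have "fin_spanned R K (X k)" for k
  proof (induction k)
    case 0
    have "X 0 \<subseteq> ?u ` carrier U"
    proof
      fix w assume w: "w \<in> X 0"
      then have wK: "w \<in> carrier K" by (simp add: X_def)
      let ?h = "\<lambda>i\<in>{..<n}. fst (w i)"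
      have "ring_comb A (\<lambda>i. fst (c i)) ?h n = ring_comb A (\<lambda>i. fst (c i)) (\<lambda>i. fst (w i)) n"
        by (rule A.ring_comb_cong) simp_all
      then have "?h \<in> carrier U" using wK K_coord[OF wK] by (auto simp: mem_U mem_K)
      moreover have "w = ?u ?h"
        using w by (intro extensionalityI[of _ "{..<n}"]) (auto simp: X_def mem_K PiE_iff prod_eq_iff)
      ultimately show "w \<in> ?u ` carrier U" by (rule rev_image_eqI[where f = ?u])
    qed
    then show ?case using fsU unfolding fin_spanned_def by blast
  next
    case (Suc k)
    show ?case
    proof (rule K.fin_spanned_add[OF Suc fsE[of k]])
      fix w assume w: "w \<in> X (Suc k)"
      then have wK: "w \<in> carrier K" by (simp add: X_def)
      show "\<exists>x\<in>X k. \<exists>y\<in>?e k ` carrier E. w = x \<oplus>\<^bsub>K\<^esub> y"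
      proof (cases "k < n")
        case True
        let ?x = "\<lambda>i\<in>{..<n}. (fst (w i), if i = k then \<zero>\<^bsub>E\<^esub> else snd (w i))"
        have "ring_comb A (\<lambda>i. fst (c i)) (\<lambda>i. fst (?x i)) n = ring_comb A (\<lambda>i. fst (c i)) (\<lambda>i. fst (w i)) n"
          by (rule A.ring_comb_cong) simp_all
        then have "?x \<in> carrier K" using wK K_coord[OF wK] by (auto simp: mem_K)
        then have "?x \<in> X k" using w by (auto simp: X_def)
        moreover have "?e k (snd (w k)) \<in> ?e k ` carrier E" using K_coord(3)[OF wK True] by blast
        moreover have "w = ?x \<oplus>\<^bsub>K\<^esub> ?e k (snd (w k))"
          using wK K_coord[OF wK]
          by (intro extensionalityI[of _ "{..<n}"]) (auto simp: K_simps mem_K PiE_iff prod_eq_iff)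
        ultimately show ?thesis by (intro bexI)
      next
        case False
        have "w \<in> X k" using w False by (auto simp: X_def)
        moreover have "?e k \<zero>\<^bsub>E\<^esub> \<in> ?e k ` carrier E" by blast
        moreover have "w = w \<oplus>\<^bsub>K\<^esub> ?e k \<zero>\<^bsub>E\<^esub>"
          using wK K_coord[OF wK]
          by (intro extensionalityI[of _ "{..<n}"]) (auto simp: K_simps mem_K PiE_iff prod_eq_iff)
        ultimately show ?thesis by (intro bexI)
      qed
    qed
  qed
  from this[of n] have "fin_spanned R K (carrier K)"
    by (simp add: X_def)
  then show ?thesis unfolding fin_gen_module_iff using K_module by blast
qed

end

end

section \<open>Transfer of weak coherence\<close>

lemma max_syzygy_module_eq:
  assumes "\<And>r i. r \<in> syzygies R a n \<Longrightarrow> i < n \<Longrightarrow> r i \<in> \<mm>"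
  shows "max_syzygy_module R \<mm> a n = syzygy_module R a n"
proof -
  have "{r \<in> syzygies R a n. \<forall>i<n. r i \<in> \<mm>} = syzygies R a n" using assms by blast
  then show ?thesis by (simp add: max_syzygy_module_def syzygy_module_def)
qed

lemma (in local_cring) minimal_presentation:
  assumes "ideal J R" "J \<noteq> carrier R" "fin_gen_module R (ideal_module R J)"
  obtains n b where "\<And>i. i < n \<Longrightarrow> b i \<in> \<mm>" "\<And>i. i < n \<Longrightarrow> b i \<in> carrier R"
    "gen_ideal R b n = J" "\<And>r i. r \<in> syzygies R b n \<Longrightarrow> i < n \<Longrightarrow> r i \<in> \<mm>"
    "fin_pres_module R (ideal_module R J) \<longleftrightarrow> fin_gen_module R (syzygy_module R b n)"
proof -
  obtain n b where b: "\<And>i. i < n \<Longrightarrow> b i \<in> J" and gen: "gen_ideal R b n = J"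
    and min: "\<And>r i. r \<in> syzygies R b n \<Longrightarrow> i < n \<Longrightarrow> r i \<in> \<mm>"
    using minimal_generators[OF assms(1,3)] by metis
  have m: "b i \<in> \<mm>" if "i < n" for i using b[OF that] proper_ideal_subset[OF assms(1,2)] by blast
  then have carr: "b i \<in> carrier R" if "i < n" for i using that max_ideal_carrier by blast
  have "fin_pres_module R (ideal_module R J) \<longleftrightarrow> fin_gen_module R (syzygy_module R b n)"
    using fin_pres_gen_ideal_iff[of n b] carr by (simp add: gen)
  then show ?thesis using that m carr gen min by blast
qed

lemma (in local_cring) gen_ideal_proper:
  assumes "\<And>i. i < n \<Longrightarrow> b i \<in> \<mm>"
  shows "gen_ideal R b n \<noteq> carrier R"
  using gen_ideal_minimal[OF max_ideal, of n b] assms one_notin by blast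

context trivial_ext begin

lemma quotient_hom:
  "(+>\<^bsub>A\<^esub>) M \<in> ring_hom A (A Quot M)"
  by (rule ideal.rcos_ring_hom[OF A.max_ideal])

lemma residue_smult:
  assumes "a \<in> carrier A" "e \<in> carrier E"
  shows "(M +>\<^bsub>A\<^esub> a) \<odot>\<^bsub>residue_space E\<^esub> e = a \<odot>\<^bsub>E\<^esub> e"
proof -
  have coset: "M +>\<^bsub>A\<^esub> a = (\<lambda>m. m \<oplus>\<^bsub>A\<^esub> a) ` M" by (auto simp: a_r_coset_def')
  have "(m \<oplus>\<^bsub>A\<^esub> a) \<odot>\<^bsub>E\<^esub> e = a \<odot>\<^bsub>E\<^esub> e" if "m \<in> M" for m
    using that assms A.max_ideal_carrier by (simp add: E.smult_l_distr)
  moreover have "\<zero>\<^bsub>A\<^esub> \<in> M"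
    by (rule additive_subgroup.zero_closed[OF ideal.axioms(1)[OF A.max_ideal]])
  ultimately have "(\<lambda>x. x \<odot>\<^bsub>E\<^esub> e) ` (M +>\<^bsub>A\<^esub> a) = {a \<odot>\<^bsub>E\<^esub> e}"
    unfolding coset by (auto simp: image_image)
  then show ?thesis by (simp add: residue_space_def)
qed

lemma residue_simps [simp]:
  "carrier (residue_space E) = carrier E"
  "\<zero>\<^bsub>residue_space E\<^esub> = \<zero>\<^bsub>E\<^esub>"
  "x \<oplus>\<^bsub>residue_space E\<^esub> y = x \<oplus>\<^bsub>E\<^esub> y"
  by (simp_all add: residue_space_def)

lemma residue_cosetE:
  assumes "C \<in> carrier (A Quot M)"
  obtains a where "a \<in> carrier A" "C = M +>\<^bsub>A\<^esub> a"
  using assms by (auto simp: FactRing_def A_RCOSETS_def')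

lemma residue_space_module: "module (A Quot M) (residue_space E)"
proof (rule moduleI)
  show "cring (A Quot M)" by (rule ideal.quotient_is_cring[OF A.max_ideal A.is_cring])
  show "abelian_group (residue_space E)"
    by (rule abelian_groupI) (auto simp: E.M.a_ac intro: E.M.l_neg)
next
  fix C x assume "C \<in> carrier (A Quot M)" and x: "x \<in> carrier (residue_space E)"
  then obtain a where "a \<in> carrier A" "C = M +>\<^bsub>A\<^esub> a" using residue_cosetE by blast
  then show "C \<odot>\<^bsub>residue_space E\<^esub> x \<in> carrier (residue_space E)"
    using x by (simp add: residue_smult)
next
  fix C D x assume "C \<in> carrier (A Quot M)" "D \<in> carrier (A Quot M)" and x: "x \<in> carrier (residue_space E)"
  then obtain a b where ab: "a \<in> carrier A" "C = M +>\<^bsub>A\<^esub> a" "b \<in> carrier A" "D = M +>\<^bsub>A\<^esub> b"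
    using residue_cosetE by metis
  show "(C \<oplus>\<^bsub>A Quot M\<^esub> D) \<odot>\<^bsub>residue_space E\<^esub> x =
      C \<odot>\<^bsub>residue_space E\<^esub> x \<oplus>\<^bsub>residue_space E\<^esub> D \<odot>\<^bsub>residue_space E\<^esub> x"
    using ring_hom_add[OF quotient_hom ab(1,3), symmetric] ab x
    by (simp add: residue_smult E.smult_l_distr)
  show "(C \<otimes>\<^bsub>A Quot M\<^esub> D) \<odot>\<^bsub>residue_space E\<^esub> x =
      C \<odot>\<^bsub>residue_space E\<^esub> (D \<odot>\<^bsub>residue_space E\<^esub> x)"
    using ring_hom_mult[OF quotient_hom ab(1,3), symmetric] ab x
    by (simp add: residue_smult E.smult_assoc1)
next
  fix C x y assume "C \<in> carrier (A Quot M)" and xy: "x \<in> carrier (residue_space E)" "y \<in> carrier (residue_space E)"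
  then obtain a where "a \<in> carrier A" "C = M +>\<^bsub>A\<^esub> a" using residue_cosetE by blast
  then show "C \<odot>\<^bsub>residue_space E\<^esub> (x \<oplus>\<^bsub>residue_space E\<^esub> y) =
      C \<odot>\<^bsub>residue_space E\<^esub> x \<oplus>\<^bsub>residue_space E\<^esub> C \<odot>\<^bsub>residue_space E\<^esub> y"
    using xy by (simp add: residue_smult E.smult_r_distr)
next
  fix x assume "x \<in> carrier (residue_space E)"
  then show "\<one>\<^bsub>A Quot M\<^esub> \<odot>\<^bsub>residue_space E\<^esub> x = x"
    using ring_hom_one[OF quotient_hom, symmetric] by (simp add: residue_smult)
qed

lemma fin_gen_residue_space_iff:
  "fin_gen_module (A Quot M) (residue_space E) \<longleftrightarrow> fin_gen_module A E"
proof
  assume fg: "fin_gen_module (A Quot M) (residue_space E)"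
  define \<sigma> where "\<sigma> C = (SOME a. a \<in> carrier A \<and> C = M +>\<^bsub>A\<^esub> a)" for C
  have \<sigma>: "\<sigma> C \<in> carrier A \<and> C = M +>\<^bsub>A\<^esub> \<sigma> C" if "C \<in> carrier (A Quot M)" for C
    unfolding \<sigma>_def by (rule someI_ex) (use residue_cosetE[OF that] in blast)
  show "fin_gen_module A E"
  proof (rule fin_gen_semilinear_image[OF fg mod_E, where h = "\<lambda>e. e" and \<sigma> = \<sigma>])
    fix C e assume "C \<in> carrier (A Quot M)" "e \<in> carrier (residue_space E)"
    then show "C \<odot>\<^bsub>residue_space E\<^esub> e = \<sigma> C \<odot>\<^bsub>E\<^esub> e"
      using \<sigma>[of C] residue_smult[of "\<sigma> C" e] by simp
  qed (use \<sigma> in auto)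
next
  assume fg: "fin_gen_module A E"
  show "fin_gen_module (A Quot M) (residue_space E)"
    by (rule fin_gen_semilinear_image[OF fg residue_space_module, where h = "\<lambda>e. e" and \<sigma> = "(+>\<^bsub>A\<^esub>) M"])
      (auto simp: residue_smult intro: ring_hom_closed[OF quotient_hom])
qed

lemma zero_comb:
  assumes "\<And>i. i < n \<Longrightarrow> r i \<in> carrier A" "\<And>i. i < n \<Longrightarrow> b i \<in> M"
  shows "ring_comb R (\<lambda>i. (b i, \<zero>\<^bsub>E\<^esub>)) (\<lambda>i. (r i, \<zero>\<^bsub>E\<^esub>)) n = (ring_comb A b r n, \<zero>\<^bsub>E\<^esub>)"
proof -
  have "lin_comb E (\<lambda>i. \<zero>\<^bsub>E\<^esub>) r n = \<zero>\<^bsub>E\<^esub>" using assms by (intro E.lin_comb_eq_zero) simp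
  then show ?thesis
    using ring_comb_ext[of n "\<lambda>i. (r i, \<zero>\<^bsub>E\<^esub>)" "\<lambda>i. (b i, \<zero>\<^bsub>E\<^esub>)"] assms by simp
qed

lemma gen_ideal_fst:
  assumes "\<And>i. i < n \<Longrightarrow> c i \<in> M \<times> carrier E" "x \<in> gen_ideal R c n"
  shows "fst x \<in> gen_ideal A (\<lambda>i. fst (c i)) n"
proof -
  from assms(2) obtain w where w: "w \<in> {..<n} \<rightarrow>\<^sub>E carrier R" "x = ring_comb R c w n"
    unfolding gen_ideal_def by blast
  have wR: "w i \<in> carrier R" if "i < n" for i using w(1) that by blast
  have "fst x = ring_comb A (\<lambda>i. fst (c i)) (\<lambda>i. fst (w i)) n"
    using ring_comb_ext[of n w c] wR assms(1) w(2) by simp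
  also have "\<dots> = ring_comb A (\<lambda>i. fst (c i)) (\<lambda>i\<in>{..<n}. fst (w i)) n"
    by (rule A.ring_comb_cong) simp_all
  finally show ?thesis
    unfolding gen_ideal_def
    by (rule image_eqI[where f = "\<lambda>r. ring_comb A (\<lambda>i. fst (c i)) r n"])
      (use wR in \<open>auto simp: mem_Times_iff\<close>)
qed

lemma weakly_coherent_of_infinite:
  assumes "\<not> fin_gen_module A E"
  shows "weakly_coherent_ring R"
proof (intro weakly_coherent_ring.intro weakly_coherent_ring_axioms.intro cring_ext)
  fix I J
  assume I: "ideal I R" and J: "ideal J R" "J \<noteq> carrier R" and IJ: "I \<subseteq> J"
    and fp: "fin_pres_module R (ideal_module R J)"
  obtain n c where c: "\<And>i. i < n \<Longrightarrow> c i \<in> M \<times> carrier E" and gen: "gen_ideal R c n = J"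
    and min: "\<And>r i. r \<in> syzygies R c n \<Longrightarrow> i < n \<Longrightarrow> r i \<in> M \<times> carrier E"
    and fp_iff: "fin_pres_module R (ideal_module R J) \<longleftrightarrow> fin_gen_module R (syzygy_module R c n)"
    using R.minimal_presentation[OF J fin_pres_imp_fin_gen[OF fp]] by metis
  have "fin_gen_module A E" if "0 < n"
    using fin_gen_E[of n c] c min fp fp_iff that by blast
  then have "n = 0" using assms by blast
  then have "J = {\<zero>\<^bsub>R\<^esub>}" using gen by (auto simp: gen_ideal_def)
  moreover have "\<zero>\<^bsub>R\<^esub> \<in> I"
    by (rule additive_subgroup.zero_closed[OF ideal.axioms(1)[OF I]])
  ultimately have "I = J" using IJ by auto
  then show "fin_pres_module R (ideal_module R I)" using fp by simp
qed

lemma weakly_coherent_of_finite: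
  assumes fgE: "fin_gen_module A E" and wc: "weakly_coherent_ring A"
  shows "weakly_coherent_ring R"
proof (intro weakly_coherent_ring.intro weakly_coherent_ring_axioms.intro cring_ext)
  fix I J
  assume I: "ideal I R" "I \<noteq> carrier R" and J: "ideal J R" "J \<noteq> carrier R" and IJ: "I \<subseteq> J"
    and fg: "fin_gen_module R (ideal_module R I)" and fp: "fin_pres_module R (ideal_module R J)"
  obtain n b where b: "\<And>i. i < n \<Longrightarrow> b i \<in> M \<times> carrier E" and genb: "gen_ideal R b n = J"
    and minb: "\<And>r i. r \<in> syzygies R b n \<Longrightarrow> i < n \<Longrightarrow> r i \<in> M \<times> carrier E"
    and fpb: "fin_pres_module R (ideal_module R J) \<longleftrightarrow> fin_gen_module R (syzygy_module R b n)"
    using R.minimal_presentation[OF J fin_pres_imp_fin_gen[OF fp]] by metis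
  obtain m c where c: "\<And>i. i < m \<Longrightarrow> c i \<in> M \<times> carrier E" and cR: "\<And>i. i < m \<Longrightarrow> c i \<in> carrier R"
    and genc: "gen_ideal R c m = I"
    and minc: "\<And>r i. r \<in> syzygies R c m \<Longrightarrow> i < m \<Longrightarrow> r i \<in> M \<times> carrier E"
    and fpc: "fin_pres_module R (ideal_module R I) \<longleftrightarrow> fin_gen_module R (syzygy_module R c m)"
    using R.minimal_presentation[OF I fg] by metis
  define \<beta> where "\<beta> = (\<lambda>i. fst (b i))"
  define \<gamma> where "\<gamma> = (\<lambda>i. fst (c i))"
  have \<beta>M: "\<beta> i \<in> M" if "i < n" for i using b[OF that] by (auto simp: \<beta>_def)
  have \<gamma>M: "\<gamma> i \<in> M" if "i < m" for i using c[OF that] by (auto simp: \<gamma>_def)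
  have \<beta>A: "\<beta> i \<in> carrier A" if "i < n" for i using \<beta>M[OF that] A.max_ideal_carrier by blast
  have \<gamma>A: "\<gamma> i \<in> carrier A" if "i < m" for i using \<gamma>M[OF that] A.max_ideal_carrier by blast
  have fgU: "fin_gen_module A (max_syzygy_module A M \<beta> n)"
    unfolding \<beta>_def using fin_gen_U[of n b] b minb fp fpb by blast
  have H\<beta>: "submodule A (syzygies A \<beta> n) (free_module A n)" using \<beta>A by (rule A.syzygies_submodule)
  have H\<gamma>: "submodule A (syzygies A \<gamma> m) (free_module A m)" using \<gamma>A by (rule A.syzygies_submodule)
  have idJ: "ideal (gen_ideal A \<beta> n) A" using \<beta>A by (rule A.gen_ideal_ideal)
  have idI: "ideal (gen_ideal A \<gamma> m) A" using \<gamma>A by (rule A.gen_ideal_ideal)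
  have sub: "gen_ideal A \<gamma> m \<subseteq> gen_ideal A \<beta> n"
  proof (rule A.gen_ideal_minimal[OF idJ])
    fix i assume "i < m"
    then have "c i \<in> gen_ideal R c m" using cR R.generator_in_gen_ideal by blast
    then have "c i \<in> gen_ideal R b n" using genb genc IJ by blast
    then show "\<gamma> i \<in> gen_ideal A \<beta> n"
      unfolding \<beta>_def \<gamma>_def using gen_ideal_fst[of n b] b by blast
  qed
  have "fin_gen_module A (syzygy_module A \<beta> n)"
    unfolding syzygy_module_def
    using A.fin_gen_from_max_coords[OF H\<beta>] fgU unfolding max_syzygy_module_def by blast
  then have "fin_pres_module A (ideal_module A (gen_ideal A \<beta> n))"
    using A.fin_pres_gen_ideal_iff[of n \<beta>] \<beta>A by blast
  moreover have "fin_gen_module A (ideal_module A (gen_ideal A \<gamma> m))"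
    using \<gamma>A by (rule A.fin_gen_gen_ideal)
  moreover have "gen_ideal A \<beta> n \<noteq> carrier A" using \<beta>M by (rule A.gen_ideal_proper)
  moreover have "gen_ideal A \<gamma> m \<noteq> carrier A" using \<gamma>M by (rule A.gen_ideal_proper)
  ultimately have "fin_pres_module A (ideal_module A (gen_ideal A \<gamma> m))"
    using weakly_coherent_ring.weakly_coherent[OF wc idI idJ] sub by blast
  then have fg\<gamma>: "fin_gen_module A (syzygy_module A \<gamma> m)"
    using A.fin_pres_gen_ideal_iff[of m \<gamma>] \<gamma>A by blast
  have "fin_gen_module A (max_syzygy_module A M \<gamma> m)"
  proof (cases "\<forall>s\<in>syzygies A \<beta> n. \<forall>j<n. s j \<in> M")
    case True
    \<comment> \<open>Here \<open>J\<close> meets \<open>0 \<times> E\<close> trivially, so the first components of the generators of \<open>I\<close> have no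
      more syzygies than the generators themselves.\<close>
    have "r i \<in> M" if r: "r \<in> syzygies A \<gamma> m" and i: "i < m" for r i
    proof -
      have rA: "r i \<in> carrier A" if "i < m" for i using r that by (auto simp: syzygies_def)
      let ?w = "\<lambda>i\<in>{..<m}. (r i, \<zero>\<^bsub>E\<^esub>)"
      have wR: "?w \<in> {..<m} \<rightarrow>\<^sub>E carrier R" using rA by auto
      have w_comb: "ring_comb R c ?w m = (ring_comb A \<gamma> r m, lin_comb E (\<lambda>i. snd (c i)) r m)"
      proof -
        have "ring_comb R c ?w m = ring_comb R c (\<lambda>i. (r i, \<zero>\<^bsub>E\<^esub>)) m"
          by (rule R.ring_comb_cong) simp_all
        then show ?thesis
          using ring_comb_ext[of m "\<lambda>i. (r i, \<zero>\<^bsub>E\<^esub>)" c] rA c by (simp add: \<gamma>_def)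
      qed
      have "ring_comb R c ?w m \<in> gen_ideal R b n"
        using wR genb genc IJ unfolding gen_ideal_def by blast
      then obtain v where v: "v \<in> {..<n} \<rightarrow>\<^sub>E carrier R" "ring_comb R c ?w m = ring_comb R b v n"
        unfolding gen_ideal_def by blast
      have vR: "v i \<in> carrier R" if "i < n" for i using v(1) that by blast
      have v_comb: "ring_comb R b v n =
          (ring_comb A \<beta> (\<lambda>i. fst (v i)) n, lin_comb E (\<lambda>i. snd (b i)) (\<lambda>i. fst (v i)) n)"
        unfolding \<beta>_def using vR b by (rule ring_comb_ext)
      have "ring_comb A \<beta> (\<lambda>i\<in>{..<n}. fst (v i)) n = ring_comb A \<beta> (\<lambda>i. fst (v i)) n"
        by (rule A.ring_comb_cong) simp_all
      also have "\<dots> = \<zero>\<^bsub>A\<^esub>" using r v(2) w_comb v_comb by (simp add: syzygies_def)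
      finally have "(\<lambda>i\<in>{..<n}. fst (v i)) \<in> syzygies A \<beta> n"
        using vR by (auto simp: syzygies_def mem_Times_iff)
      then have vM: "fst (v i) \<in> M" if "i < n" for i using True that by fastforce
      have "lin_comb E (\<lambda>i. snd (b i)) (\<lambda>i. fst (v i)) n = \<zero>\<^bsub>E\<^esub>"
        using vM b by (intro E.lin_comb_eq_zero) (auto simp: mem_Times_iff)
      then have "ring_comb R c ?w m = \<zero>\<^bsub>R\<^esub>" using r v(2) w_comb v_comb by (simp add: syzygies_def)
      then have "?w \<in> syzygies R c m" using wR by (simp add: syzygies_def)
      from minc[OF this i] show ?thesis using i by simp
    qed
    then have "max_syzygy_module A M \<gamma> m = syzygy_module A \<gamma> m" by (rule max_syzygy_module_eq)
    then show ?thesis using fg\<gamma> by simp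
  next
    case False
    then obtain s j where "s \<in> syzygies A \<beta> n" "j < n" "s j \<notin> M" by blast
    with \<beta>A have "fin_gen_module A (ideal_module A M)" using fgU by (rule A.fin_gen_max_ideal)
    then show ?thesis
      using A.fin_gen_max_coords[OF H\<gamma>] fg\<gamma> unfolding max_syzygy_module_def syzygy_module_def by blast
  qed
  then have "fin_gen_module R (syzygy_module R c m)"
    using fin_gen_K[of m c] c minc fgE unfolding \<gamma>_def by blast
  then show "fin_pres_module R (ideal_module R I)" using fpc by simp
qed

lemma weakly_coherent_base:
  assumes fgE: "fin_gen_module A E" and wc: "weakly_coherent_ring R"
  shows "weakly_coherent_ring A"
proof (intro weakly_coherent_ring.intro weakly_coherent_ring_axioms.intro A.is_cring)
  fix I J
  assume I: "ideal I A" "I \<noteq> carrier A" and J: "ideal J A" "J \<noteq> carrier A" and IJ: "I \<subseteq> J"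
    and fg: "fin_gen_module A (ideal_module A I)" and fp: "fin_pres_module A (ideal_module A J)"
  obtain n b where b: "\<And>i. i < n \<Longrightarrow> b i \<in> M" and genb: "gen_ideal A b n = J"
    and minb: "\<And>r i. r \<in> syzygies A b n \<Longrightarrow> i < n \<Longrightarrow> r i \<in> M"
    and fpb: "fin_pres_module A (ideal_module A J) \<longleftrightarrow> fin_gen_module A (syzygy_module A b n)"
    using A.minimal_presentation[OF J fin_pres_imp_fin_gen[OF fp]] by metis
  obtain m a where a: "\<And>i. i < m \<Longrightarrow> a i \<in> M" and aA: "\<And>i. i < m \<Longrightarrow> a i \<in> carrier A"
    and gena: "gen_ideal A a m = I"
    and mina: "\<And>r i. r \<in> syzygies A a m \<Longrightarrow> i < m \<Longrightarrow> r i \<in> M"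
    and fpa: "fin_pres_module A (ideal_module A I) \<longleftrightarrow> fin_gen_module A (syzygy_module A a m)"
    using A.minimal_presentation[OF I fg] by metis
  let ?b = "\<lambda>i. (b i, \<zero>\<^bsub>E\<^esub>)" and ?a = "\<lambda>i. (a i, \<zero>\<^bsub>E\<^esub>)"
  have bM: "?b i \<in> M \<times> carrier E" if "i < n" for i using b[OF that] by simp
  have aM: "?a i \<in> M \<times> carrier E" if "i < m" for i using a[OF that] by simp
  have bR: "?b i \<in> carrier R" if "i < n" for i using b[OF that] A.max_ideal_carrier by simp
  have aR: "?a i \<in> carrier R" if "i < m" for i using a[OF that] A.max_ideal_carrier by simp
  have lift_min: "w i \<in> M \<times> carrier E"
    if x: "\<And>i. i < k \<Longrightarrow> x i \<in> M" "\<And>r i. r \<in> syzygies A x k \<Longrightarrow> i < k \<Longrightarrow> r i \<in> M"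
      and w: "w \<in> syzygies R (\<lambda>i. (x i, \<zero>\<^bsub>E\<^esub>)) k" and i: "i < k" for x k w i
  proof -
    have wR: "w i \<in> carrier R" if "i < k" for i using w that unfolding syzygies_def by blast
    have "ring_comb A x (\<lambda>i\<in>{..<k}. fst (w i)) k = ring_comb A x (\<lambda>i. fst (w i)) k"
      by (rule A.ring_comb_cong) simp_all
    also have "\<dots> = \<zero>\<^bsub>A\<^esub>"
      using ring_comb_ext[of k w "\<lambda>i. (x i, \<zero>\<^bsub>E\<^esub>)"] wR x(1) w by (simp add: syzygies_def)
    finally have "(\<lambda>i\<in>{..<k}. fst (w i)) \<in> syzygies A x k"
      using wR by (auto simp: syzygies_def mem_Times_iff)
    from x(2)[OF this i] show ?thesis using wR[OF i] i by (simp add: mem_Times_iff)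
  qed
  have minb': "w i \<in> M \<times> carrier E" if "w \<in> syzygies R ?b n" "i < n" for w i
    using lift_min[of n b w i] b minb that by blast
  have mina': "w i \<in> M \<times> carrier E" if "w \<in> syzygies R ?a m" "i < m" for w i
    using lift_min[of m a w i] a mina that by blast
  have idJ: "ideal (gen_ideal R ?b n) R" using bR by (rule R.gen_ideal_ideal)
  have idI: "ideal (gen_ideal R ?a m) R" using aR by (rule R.gen_ideal_ideal)
  have sub: "gen_ideal R ?a m \<subseteq> gen_ideal R ?b n"
  proof (rule R.gen_ideal_minimal[OF idJ])
    fix i assume "i < m"
    then have "a i \<in> gen_ideal A a m" using aA A.generator_in_gen_ideal by blast
    then have "a i \<in> gen_ideal A b n" using gena genb IJ by blast
    then obtain r where r: "r \<in> {..<n} \<rightarrow>\<^sub>E carrier A" "a i = ring_comb A b r n"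
      unfolding gen_ideal_def by blast
    have rA: "r i \<in> carrier A" if "i < n" for i using r(1) that by blast
    let ?r = "\<lambda>i\<in>{..<n}. (r i, \<zero>\<^bsub>E\<^esub>)"
    have "ring_comb R ?b ?r n = ring_comb R ?b (\<lambda>i. (r i, \<zero>\<^bsub>E\<^esub>)) n"
      by (rule R.ring_comb_cong) simp_all
    also have "\<dots> = ?a i" using zero_comb[of n r b] rA b r(2) by simp
    finally have "?a i = ring_comb R ?b ?r n" by simp
    then show "?a i \<in> gen_ideal R ?b n"
      unfolding gen_ideal_def
      by (rule image_eqI[where f = "\<lambda>r. ring_comb R ?b r n"]) (use rA in auto)
  qed
  have "fin_gen_module A (max_syzygy_module A M b n)"
    using max_syzygy_module_eq[of A b n M] minb fp fpb by simp
  then have "fin_gen_module R (syzygy_module R ?b n)"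
    using fin_gen_K[of n ?b] bM minb' fgE by simp
  then have "fin_pres_module R (ideal_module R (gen_ideal R ?b n))"
    using R.fin_pres_gen_ideal_iff[of n ?b] bR by blast
  moreover have "fin_gen_module R (ideal_module R (gen_ideal R ?a m))"
    using aR by (rule R.fin_gen_gen_ideal)
  moreover have "gen_ideal R ?b n \<noteq> carrier R" using bM by (rule R.gen_ideal_proper)
  moreover have "gen_ideal R ?a m \<noteq> carrier R" using aM by (rule R.gen_ideal_proper)
  ultimately have "fin_pres_module R (ideal_module R (gen_ideal R ?a m))"
    using weakly_coherent_ring.weakly_coherent[OF wc idI idJ] sub by blast
  then have "fin_gen_module R (syzygy_module R ?a m)"
    using R.fin_pres_gen_ideal_iff[of m ?a] aR by blast
  then have "fin_gen_module A (max_syzygy_module A M a m)"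
    using fin_gen_U[of m ?a] aM mina' by simp
  then show "fin_pres_module A (ideal_module A I)"
    using max_syzygy_module_eq[of A a m M] mina fpa by simp
qed

end

theorem theorem2p6:
  fixes A :: "('a, 'm) ring_scheme" and M :: "'a set" and E :: "('a, 'b, 'n) module_scheme"
  assumes "local_ring A M"
    and "module A E"
    and "\<forall>m\<in>M. \<forall>e\<in>carrier E. m \<odot>\<^bsub>E\<^esub> e = \<zero>\<^bsub>E\<^esub>"
  shows "weakly_coherent_ring (A \<propto> E) \<longleftrightarrow>
    (vectorspace (A Quot M) (residue_space E) \<and>
       \<not> vectorspace.fin_dim (A Quot M) (residue_space E)) \<or>
    (vectorspace (A Quot M) (residue_space E) \<and>
       vectorspace.fin_dim (A Quot M) (residue_space E) \<and> weakly_coherent_ring A)"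
proof -
  interpret trivial_ext A M E
    using assms local_ring_local_cring by (intro trivial_ext.intro) blast+
  have "maximalideal M A" by (rule local_ring.maximal[OF assms(1)])
  then have "field (A Quot M)" by (rule maximalideal.quotient_is_field[OF _ A.is_cring])
  then have vs: "vectorspace (A Quot M) (residue_space E)"
    using residue_space_module by (intro vectorspace.intro)
  have "vectorspace.fin_dim (A Quot M) (residue_space E) \<longleftrightarrow> fin_gen_module A E"
    unfolding fin_gen_residue_space_iff[symmetric]
    unfolding vectorspace.fin_dim_def[OF vs] fin_gen_module_def
    using residue_space_module by blast
  then show ?thesis
    using vs weakly_coherent_of_infinite weakly_coherent_of_finite weakly_coherent_base by blast
qed

end
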